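(* Let $\beta_0=0.50057$. For all real $p$ with $2\beta_0=1.00114\le p\le 2$, all integers $n\ge 1$ and all $f:\{0,1\}^n\to\{0,1\}$, \[ \|\nabla f\|_p\ \ge\ \|f-\mathbf{E}f\|_p , \] and equality is achieved when $f=\mathbf{1}_A$ for a half-cube $A$. Moreover, for all $n\ge1$ and all $f:\{0,1\}^n\to\{0,1\}$, \[ \|\nabla f\|_1\ \ge\ 0.997\,\|f-\mathbf{E}f\|_1 . \]
   Context: For $f:\{0,1\}^n\to\mathbb{C}$, $\mathbf{E}f=2^{-n}\sum_{x\in\{0,1\}^n}f(x)$, $\|f\|_p=(\mathbf{E}|f|^p)^{1/p}$, and $|\nabla f|$ is the function given by \[ |\nabla f|^2(x)=\sum_{i=1}^n\big|\tfrac12(f(x)-f(x\oplus e_i))\big|^2, \] where $x\oplus e_i$ is $x$ with the $i$th bit flipped; $\|\nabla f\|_p=\||\nabla f|\|_p$. A half-cube is a subcube of codimension $1$, i.e. a set $\{x: x_i=a\}$ for some $i\in\{1,\dots,n\}$ and $a\in\{0,1\}$. *)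

theory Defs
  imports Complex_Main "HOL-Library.FuncSet" "HOL-Library.Indicator_Function"
begin

text \<open>Points of \<open>{0,1}\<^sup>n\<close> are extensional functions on \<open>{1..n}\<close>, so that the dimension \<open>n\<close>
  is an ordinary natural number. Functions on the cube are HOL functions of which only the
  values on \<open>cube n\<close> matter.\<close>

definition cube :: "nat \<Rightarrow> (nat \<Rightarrow> nat) set" where
  "cube n = {1..n} \<rightarrow>\<^sub>E {0, 1}"

definition flip :: "nat \<Rightarrow> (nat \<Rightarrow> nat) \<Rightarrow> (nat \<Rightarrow> nat)" where
  "flip i x = x(i := 1 - x i)"

definition mean :: "nat \<Rightarrow> ((nat \<Rightarrow> nat) \<Rightarrow> 'a::real_normed_field) \<Rightarrow> 'a" where
  "mean n f = (\<Sum>x\<in>cube n. f x) / 2 ^ n"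

definition lp_norm :: "nat \<Rightarrow> real \<Rightarrow> ((nat \<Rightarrow> nat) \<Rightarrow> 'a::real_normed_field) \<Rightarrow> real" where
  "lp_norm n p f = (mean n (\<lambda>x. norm (f x) powr p)) powr (1 / p)"

definition grad :: "nat \<Rightarrow> ((nat \<Rightarrow> nat) \<Rightarrow> complex) \<Rightarrow> (nat \<Rightarrow> nat) \<Rightarrow> real" where
  "grad n f x = sqrt (\<Sum>i\<in>{1..n}. (cmod ((f x - f (flip i x)) / 2))\<^sup>2)"

definition half_cube :: "nat \<Rightarrow> (nat \<Rightarrow> nat) set \<Rightarrow> bool" where
  "half_cube n A \<longleftrightarrow> (\<exists>i\<in>{1..n}. \<exists>a\<in>{0, 1}. A = {x \<in> cube n. x i = a})"

definition beta0 :: real where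
  "beta0 = 0.50057"

end

theory Submission
  imports Defs
begin

text \<open>Let \<open>A = {x. f x = 1}\<close> have density \<open>a\<close>, and let \<open>s x\<close> be the number of edges at \<open>x\<close> that join
\<open>A\<close> to its complement. Then \<open>\<bar>\<nabla>f\<bar> = sqrt s / 2\<close>. As \<open>s\<close> takes integer values,
\<open>s powr (p/2) \<ge> sqrt s\<close> for \<open>p \<ge> 1\<close>, while convexity of \<open>p \<mapsto> u powr p\<close> gives
\<open>2 powr p * (a * (1 - a) powr p + (1 - a) * a powr p) \<le> 4 * a * (1 - a)\<close> for \<open>1 \<le> p \<le> 2\<close>.
Both inequalities of the theorem therefore follow from the single estimate
\<open>E (sqrt s) \<ge> 4 * a * (1 - a)\<close>. For a half-cube, \<open>s = 1\<close> everywhere and \<open>\<bar>\<nabla>f\<bar> = \<bar>f - 1/2\<bar> = 1/2\<close>.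

The sum over \<open>s\<close> splits into the points of \<open>A\<close> and those of its complement, so it is enough to find
a function \<open>b\<close> on \<open>[0,1]\<close> (called \<open>profile\<close> below) such that \<open>b a + b (1 - a) \<ge> 4 * a * (1 - a)\<close>
and \<open>E (sqrt h) \<ge> b a\<close>, where \<open>h\<close> counts the edges leaving \<open>A\<close> at points of \<open>A\<close> and vanishes
elsewhere. The second property is proved by induction on the dimension. Cut the cube into two
facets in which \<open>A\<close> has densities \<open>y \<le> x\<close>. In the denser facet \<open>h\<close> grows by \<open>1\<close> on a set of
density at least \<open>d = x - y\<close>, and the mean of \<open>sqrt (h + 1\<^sub>D)\<close> is bounded below in two ways: by
\<open>sqrt (d\<^sup>2 + b(x)\<^sup>2)\<close>, which is Minkowski's inequality, and by \<open>d + \<kappa> * b x\<close> with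
\<open>\<kappa> = 0.4142 < sqrt 2 - 1\<close>, which uses that \<open>h\<close> is integer valued. The induction step is the two-point
inequality \<open>2 * b ((x + y)/2) \<le> b y + max (sqrt (d\<^sup>2 + b(x)\<^sup>2)) (d + \<kappa> * b x)\<close>
(\<open>two_point_inequality\<close>).

Half-cubes force \<open>b (1/2) \<le> 1/2\<close>, hence equality; subcubes of codimension two force \<open>b (1/4) \<le> sqrt 2 / 4\<close>, the limit \<open>y \<rightarrow> x\<close>
forces \<open>b * b'' \<ge> -2\<close>, and the bound for \<open>b a + b (1 - a)\<close> forces the slope of \<open>b\<close> to the right
of \<open>1/2\<close> to be at least the slope to the left. The profile used here is quadratic on \<open>[0,1/2]\<close>; on \<open>[1/2,1]\<close>
there is little room between these constraints, and a polynomial in \<open>s = sqrt (2 * (1 - x))\<close>, which can be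
steep near \<open>x = 1\<close>, satisfies all of them. Its coefficients were found numerically and
then rounded so that the two pieces have the same slope \<open>0.187\<close> at \<open>1/2\<close>.

The two-point inequality has two free variables, but every case reduces to polynomial
inequalities in one variable. If \<open>(x + y)/2 \<le> 1/2\<close>, then for fixed \<open>x\<close> both
bounds are concave quadratics in \<open>d\<^sup>2\<close> or in \<open>d\<close>, so endpoints suffice. If
\<open>(x + y)/2 \<ge> 1/2\<close>, one fixes \<open>y\<close> and differentiates the Minkowski bound along \<open>m = (x + y)/2\<close>; its sign is
governed by \<open>b * b'' \<ge> -2\<close> (\<open>minkowski_gap_nonneg\<close>).\<close>

section \<open>Nonnegative polynomials on an interval\<close>

text \<open>A homogeneous form in \<open>u\<close> and \<open>v\<close>; with \<open>u = x -
\<alpha>\<close> and \<open>v = \<beta> - x\<close> the list holds, up to binomial factors, the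
Bernstein coefficients of a polynomial on \<open>[\<alpha>,\<beta>]\<close>. Nonnegative entries
certify that the polynomial is nonnegative there; the certificates below are exact rational
identities.\<close>

fun bernstein :: "real list \<Rightarrow> real \<Rightarrow> real \<Rightarrow> real" where
  "bernstein [] u v = 0"
| "bernstein (c # cs) u v = c * v ^ length cs + u * bernstein cs u v"

lemma bernstein_nonneg:
  "list_all (\<lambda>c. 0 \<le> c) cs \<Longrightarrow> 0 \<le> u \<Longrightarrow> 0 \<le> v \<Longrightarrow> 0 \<le> bernstein cs u v"
  by (induction cs) auto

lemma nonneg_by_bernstein:
  assumes "p * k = bernstein cs u v" "0 < k" "list_all (\<lambda>c. 0 \<le> c) cs" "0 \<le> u" "0 \<le> v"
  shows "0 \<le> p"
  using bernstein_nonneg[OF assms(3-5)] assms(1,2) by (metis zero_le_mult_iff not_less)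

section \<open>The profile\<close>

text \<open>The coefficient \<open>\<alpha> = 813/500\<close> satisfies \<open>\<alpha> / 2 +
\<alpha>\<^sup>2 / 16 < 1\<close>, which is the two-point inequality at \<open>(x, y) = (1/2,
0)\<close>, and makes the slope at \<open>1/2\<close> equal to \<open>1 - \<alpha> / 2 =
187/1000\<close>.\<close>

definition left_profile :: "real \<Rightarrow> real" where
  "left_profile x = x + 813/500 * x * (1/2 - x)"

definition right_factor :: "real \<Rightarrow> real" where
  "right_factor s = 248/125 - 223/100 * s + 239/200 * s^2 - 449/1000 * s^3"

definition corner_root :: "real \<Rightarrow> real" where
  "corner_root x = sqrt (2 * (1 - x))"

text \<open>The values of \<open>right_factor 1\<close> and of the slope at \<open>x = 1/2\<close>,
that is \<open>corner_root x = 1\<close>, are \<open>1/2\<close> and \<open>187/1000\<close>, so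
that this piece continues \<open>left_profile\<close> continuously differentiably.\<close>

definition right_profile :: "real \<Rightarrow> real" where
  "right_profile x = 2 * (1 - x) * right_factor (corner_root x)"

text \<open>The derivative of \<open>right_profile\<close>; in terms of \<open>s = corner_root
x\<close> one has \<open>right_profile x = s\<^sup>2 * right_factor s\<close> and \<open>ds/dx = -
1/s\<close>, so that the first derivative is a polynomial in \<open>s\<close>.\<close>

definition right_slope :: "real \<Rightarrow> real" where
  "right_slope x = - (496/125 - 669/100 * corner_root x + 239/50 * (corner_root x)^2 - 449/200 * (corner_root x)^3)"

text \<open>The second derivative of \<open>right_profile\<close> at \<open>x\<close> is \<open>-
right_curvature s / s\<close> with \<open>s = corner_root x\<close>.\<close>

definition right_curvature :: "real \<Rightarrow> real" where
  "right_curvature s = 669/100 - 239/25 * s + 1347/200 * s^2"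

definition profile :: "real \<Rightarrow> real" where
  "profile x = (if x \<le> 1/2 then left_profile x else right_profile x)"

section \<open>Differential inequalities for the upper half of the profile\<close>

text \<open>This is \<open>b * b'' \<ge> -2\<close> in the coordinate \<open>s\<close>, the
infinitesimal form of the two-point inequality. It is nearly an equality around \<open>s =
1/2\<close>, whence the subdivision.\<close>

lemma right_curvature_le:
  assumes "0 \<le> s" "s \<le> 1"
  shows "s * right_factor s * right_curvature s \<le> 2"
proof -
  let ?p = "2 - s * right_factor s * right_curvature s"
  consider "s \<le> 9/20" | "9/20 \<le> s" "s \<le> 3/5" | "3/5 \<le> s" by linarith
  then have "0 \<le> ?p"
  proof cases
    case 1
    show ?thesis
    proof (rule nonneg_by_bernstein)
      show "?p * 6802444800000000000 = bernstein [25600000000000, 77147750400000, 89570590080000, 49028048144000, 12594280804800, 1333186167660, 65530937983] (20 * s) (9 - 20 * s)"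
        by (simp add: right_factor_def right_curvature_def field_simps) algebra
    qed (use assms 1 in auto)
  next
    case 2
    show ?thesis
    proof (rule nonneg_by_bernstein)
      show "?p * 9331200000000000 = bernstein [65530937983, 79852114644, 184220285280, 853713278720, 1341785483520, 849178328064, 191647916032] (20 * s - 9) (12 - 20 * s)"
        by (simp add: right_factor_def right_curvature_def field_simps) algebra
    qed (use assms 2 in auto)
  next
    case 3
    show ?thesis
    proof (rule nonneg_by_bernstein)
      show "?p * 100000000000 = bernstein [23394521, 238254225, 814843400, 1008156250, 517210625, 195153125, 105468750] (5 * s - 3) (5 - 5 * s)"
        by (simp add: right_factor_def right_curvature_def field_simps) algebra
    qed (use assms 3 in auto)
  qed
  then show ?thesis by linarith
qed

text \<open>Where the profile increases, \<open>b * b'' \<ge> -2\<close> alone is too weak, because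
the growth of \<open>b\<close> works against the two-point inequality. The surplus needed is the
square of the slope of \<open>b\<close> at \<open>1/2\<close>, after the term
\<open>(b')\<^sup>2\<close> has been added.\<close>

lemma right_curvature_slope_le:
  assumes "0 \<le> s" "s \<le> 1"
  shows "s * right_factor s * right_curvature s \<le> 2 + (496/125 - 669/100 * s + 239/50 * s^2 - 449/200 * s^3)^2 - (187/1000)^2"
proof -
  let ?p = "2 + (496/125 - 669/100 * s + 239/50 * s^2 - 449/200 * s^3)^2 - (187/1000)^2 - s * right_factor s * right_curvature s"
  consider "s \<le> 9/10" | "9/10 \<le> s" "s \<le> 19/20" | "19/20 \<le> s" by linarith
  then have "0 \<le> ?p"
  proof cases
    case 1
    show ?thesis
    proof (rule nonneg_by_bernstein)
      show "?p * 53144100000000000 = bernstein [1771005500000, 4653201000000, 6143572020000, 4390106281000, 1677719094600, 123404145915, 2970960479] (10 * s) (9 - 10 * s)"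
        by (simp add: right_factor_def right_curvature_def field_simps) algebra
    qed (use assms 1 in auto)
  next
    case 2
    show ?thesis
    proof (rule nonneg_by_bernstein)
      show "?p * 3200000000000 = bernstein [95070735328, 382729508784, 596748269280, 467401572920, 223513127070, 88601223399, 23400576627] (20 * s - 18) (19 - 20 * s)"
        by (simp add: right_factor_def right_curvature_def field_simps) algebra
    qed (use assms 2 in auto)
  next
    case 3
    show ?thesis
    proof (rule nonneg_by_bernstein)
      show "?p * 3200000000000 = bernstein [23400576627, 192205696125, 741535490700, 1520746768000, 1684694400000, 952677600000, 216000000000] (20 * s - 19) (20 - 20 * s)"
        by (simp add: right_factor_def right_curvature_def field_simps) algebra
    qed (use assms 3 in auto)
  qed
  then show ?thesis by linarith
qed

lemma corner_root_sq: "x \<le> 1 \<Longrightarrow> (corner_root x)\<^sup>2 = 2 * (1 - x)"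
  by (simp add: corner_root_def)

lemma corner_root_bounds:
  assumes "1/2 \<le> x" "x \<le> 1" shows "0 \<le> corner_root x" "corner_root x \<le> 1"
  using assms by (auto simp: corner_root_def)

lemma corner_root_pos: "x < 1 \<Longrightarrow> 0 < corner_root x"
  by (simp add: corner_root_def)

lemma cont_corner_root [continuous_intros]:
  "continuous_on S f \<Longrightarrow> continuous_on S (\<lambda>x. corner_root (f x))"
  unfolding corner_root_def by (intro continuous_intros)

lemma cont_right_profile [continuous_intros]:
  "continuous_on S f \<Longrightarrow> continuous_on S (\<lambda>x. right_profile (f x))"
  unfolding right_profile_def right_factor_def by (intro continuous_intros)

lemma cont_right_slope [continuous_intros]:
  "continuous_on S f \<Longrightarrow> continuous_on S (\<lambda>x. right_slope (f x))"
  unfolding right_slope_def by (intro continuous_intros)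

lemma DERIV_corner_root:
  assumes "x < 1" shows "(corner_root has_real_derivative - 1 / corner_root x) (at x)"
  unfolding corner_root_def
  by (rule derivative_eq_intros refl | use assms in \<open>simp add: field_simps\<close>)+

lemma DERIV_right_profile:
  assumes "x < 1" shows "(right_profile has_real_derivative right_slope x) (at x)"
proof -
  have s: "0 < corner_root x" "2 * (1 - x) = corner_root x * corner_root x"
    using corner_root_pos[OF assms] corner_root_sq[of x] assms by (auto simp: power2_eq_square)
  have "(right_profile has_real_derivative
      (- 2) * right_factor (corner_root x) + 2 * (1 - x) * ((- 223/100 + 239/100 * corner_root x - 1347/1000 * (corner_root x)^2) * (- 1 / corner_root x))) (at x)"
    unfolding right_profile_def right_factor_def
    by (rule derivative_eq_intros DERIV_corner_root[OF assms] refl)+ (use s(1) in \<open>simp add: field_simps\<close>)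
  moreover have "(- 2) * right_factor (corner_root x) + 2 * (1 - x) * ((- 223/100 + 239/100 * corner_root x - 1347/1000 * (corner_root x)^2) * (- 1 / corner_root x)) = right_slope x"
    unfolding s(2) using s(1) by (simp add: right_factor_def right_slope_def field_simps power2_eq_square power3_eq_cube)
  ultimately show ?thesis by simp
qed

lemma DERIV_right_slope:
  assumes "x < 1" shows "(right_slope has_real_derivative - right_curvature (corner_root x) / corner_root x) (at x)"
proof -
  have s: "0 < corner_root x" using corner_root_pos[OF assms] .
  have "(right_slope has_real_derivative
      - ((- 669/100 + 239/25 * corner_root x - 1347/200 * (corner_root x)^2) * (- 1 / corner_root x))) (at x)"
    unfolding right_slope_def
    by (rule derivative_eq_intros DERIV_corner_root[OF assms] refl)+ (use s in \<open>simp add: field_simps\<close>)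
  moreover have "- ((- 669/100 + 239/25 * corner_root x - 1347/200 * (corner_root x)^2) * (- 1 / corner_root x)) = - right_curvature (corner_root x) / corner_root x"
    using s by (simp add: right_curvature_def field_simps)
  ultimately show ?thesis by simp
qed

lemma DERIV_right_profile_slope:
  assumes "x < 1"
  shows "((\<lambda>x. right_profile x * right_slope x) has_real_derivative (right_slope x)\<^sup>2 - corner_root x * right_factor (corner_root x) * right_curvature (corner_root x)) (at x)"
proof -
  have s: "0 < corner_root x" "2 * (1 - x) = corner_root x * corner_root x"
    using corner_root_pos[OF assms] corner_root_sq[of x] assms by (auto simp: power2_eq_square)
  have "((\<lambda>x. right_profile x * right_slope x) has_real_derivative right_slope x * right_slope x + (- right_curvature (corner_root x) / corner_root x) * right_profile x) (at x)"
    by (rule DERIV_mult[OF DERIV_right_profile[OF assms] DERIV_right_slope[OF assms]])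
  moreover have "right_slope x * right_slope x + (- right_curvature (corner_root x) / corner_root x) * right_profile x = (right_slope x)\<^sup>2 - corner_root x * right_factor (corner_root x) * right_curvature (corner_root x)"
    unfolding right_profile_def s(2) using s(1) by (simp add: power2_eq_square)
  ultimately show ?thesis by simp
qed

lemma right_curvature_lower: "187/50 * s \<le> right_curvature s"
proof -
  have "right_curvature s - 187/50 * s = 1347/200 * (s - 1330/1347)^2 + (669/100 - 1347/200 * (1330/1347)^2)"
    by (simp add: right_curvature_def field_simps power2_eq_square)
  also have "0 \<le> \<dots>" by (intro add_nonneg_nonneg) (auto simp: power2_eq_square)
  finally show ?thesis by linarith
qed

lemma right_slope_decreasing:
  assumes "1/2 \<le> x" "x \<le> y" "y \<le> 1"
  shows "right_slope y \<le> right_slope x - 187/50 * (y - x)"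
proof -
  have "right_slope y + 187/50 * y \<le> right_slope x + 187/50 * x"
  proof (rule DERIV_nonpos_imp_decreasing_open[OF assms(2)])
    fix t assume t: "x < t" "t < y"
    then have "0 < corner_root t" using assms by (intro corner_root_pos) auto
    then have "- right_curvature (corner_root t) / corner_root t + 187/50 \<le> 0"
      using right_curvature_lower[of "corner_root t"] by (simp add: field_simps)
    moreover have "((\<lambda>u. right_slope u + 187/50 * u) has_real_derivative - right_curvature (corner_root t) / corner_root t + 187/50) (at t)"
      using t assms by (auto intro!: derivative_eq_intros DERIV_right_slope)
    ultimately show "\<exists>z. ((\<lambda>u. right_slope u + 187/50 * u) has_real_derivative z) (at t) \<and> z \<le> 0"
      by blast
  qed (intro continuous_intros)
  then show ?thesis by (simp add: field_simps)
qed

lemma right_slope_antimono: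
  assumes "1/2 \<le> x" "x \<le> y" "y \<le> 1"
  shows "right_slope y \<le> right_slope x"
proof -
  have "0 \<le> 187/50 * (y - x)" using assms by simp
  with right_slope_decreasing[OF assms] show ?thesis by linarith
qed

lemma right_slope_half: "right_slope (1/2) = 187/1000"
  by (simp add: right_slope_def corner_root_def)

lemma right_profile_half: "right_profile (1/2) = 1/2"
  by (simp add: right_profile_def right_factor_def corner_root_def)

lemma right_profile_below_tangent:
  assumes "1/2 \<le> x" "x \<le> 1" "1/2 \<le> m" "m \<le> 1"
  shows "right_profile x \<le> right_profile m + right_slope m * (x - m)"
proof -
  let ?f = "\<lambda>t. right_profile t - right_slope m * t"
  have D: "(?f has_real_derivative right_slope t - right_slope m) (at t)" if "t < 1" for t
    using that by (auto intro!: derivative_eq_intros DERIV_right_profile)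
  have c: "continuous_on S ?f" for S by (intro continuous_intros)
  have "?f x \<le> ?f m"
  proof (cases "x \<le> m")
    case True
    then show ?thesis
    proof (rule DERIV_nonneg_imp_increasing_open[OF _ _ c])
      fix t assume t: "x < t" "t < m"
      have "right_slope m \<le> right_slope t" using t assms by (intro right_slope_antimono) auto
      then have "0 \<le> right_slope t - right_slope m" by linarith
      then show "\<exists>y. (?f has_real_derivative y) (at t) \<and> 0 \<le> y" using D[of t] t assms by force
    qed
  next
    case False
    then have "m \<le> x" by simp
    then show ?thesis
    proof (rule DERIV_nonpos_imp_decreasing_open[OF _ _ c])
      fix t assume t: "m < t" "t < x"
      have "right_slope t \<le> right_slope m" using t assms by (intro right_slope_antimono) auto
      then have "right_slope t - right_slope m \<le> 0" by linarith
      then show "\<exists>y. (?f has_real_derivative y) (at t) \<and> y \<le> 0" using D[of t] t assms by force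
    qed
  qed
  then show ?thesis by (simp add: algebra_simps)
qed

text \<open>The derivative of \<open>b * b'\<close> is \<open>(b')\<^sup>2 + b *
b''\<close>.\<close>

lemma profile_slope_growth:
  assumes "1/2 \<le> m" "m \<le> x" "x \<le> 1"
    and c: "\<And>t. m < t \<Longrightarrow> t < x \<Longrightarrow> c - 2 \<le> (right_slope t)\<^sup>2 - corner_root t * right_factor (corner_root t) * right_curvature (corner_root t)"
  shows "(c - 2) * (x - m) \<le> right_profile x * right_slope x - right_profile m * right_slope m"
proof -
  have "right_profile m * right_slope m - (c - 2) * m \<le> right_profile x * right_slope x - (c - 2) * x"
  proof (rule DERIV_nonneg_imp_increasing_open[OF assms(2)])
    fix t assume t: "m < t" "t < x"
    then have "((\<lambda>u. right_profile u * right_slope u - (c - 2) * u) has_real_derivative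
        (right_slope t)\<^sup>2 - corner_root t * right_factor (corner_root t) * right_curvature (corner_root t) - (c - 2)) (at t)"
      using assms by (intro DERIV_cong[OF DERIV_diff[OF DERIV_right_profile_slope DERIV_cmult[OF DERIV_ident]]]) auto
    then show "\<exists>y. ((\<lambda>u. right_profile u * right_slope u - (c - 2) * u) has_real_derivative y) (at t) \<and> 0 \<le> y"
      using c[OF t] by force
  qed (intro continuous_intros)
  then show ?thesis by (simp add: algebra_simps)
qed

lemma profile_slope_growth_falling:
  assumes "1/2 \<le> m" "m \<le> x" "x \<le> 1" "right_slope m \<le> 0"
  shows "((right_slope m)\<^sup>2 - 2) * (x - m) \<le> right_profile x * right_slope x - right_profile m * right_slope m"
proof (rule profile_slope_growth[OF assms(1-3)])
  fix t assume t: "m < t" "t < x"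
  have "right_slope t \<le> right_slope m" using t assms by (intro right_slope_antimono) auto
  then have "(right_slope m)\<^sup>2 \<le> (right_slope t)\<^sup>2" using assms(4) by (simp add: abs_le_square_iff[symmetric])
  moreover have "corner_root t * right_factor (corner_root t) * right_curvature (corner_root t) \<le> 2"
    using t assms by (intro right_curvature_le corner_root_bounds) auto
  ultimately show "(right_slope m)\<^sup>2 - 2 \<le> (right_slope t)\<^sup>2 - corner_root t * right_factor (corner_root t) * right_curvature (corner_root t)" by linarith
qed

lemma profile_slope_growth_rising:
  assumes "1/2 \<le> m" "m \<le> x" "x \<le> 1"
  shows "((187/1000)\<^sup>2 - 2) * (x - m) \<le> right_profile x * right_slope x - right_profile m * right_slope m"
proof (rule profile_slope_growth[OF assms])
  fix t assume t: "m < t" "t < x"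
  have "corner_root t * right_factor (corner_root t) * right_curvature (corner_root t) \<le> 2 + (right_slope t)\<^sup>2 - (187/1000)\<^sup>2"
    using right_curvature_slope_le[of "corner_root t"] corner_root_bounds[of t] t assms unfolding right_slope_def power2_minus by auto
  then show "(187/1000)\<^sup>2 - 2 \<le> (right_slope t)\<^sup>2 - corner_root t * right_factor (corner_root t) * right_curvature (corner_root t)" by linarith
qed

text \<open>For fixed \<open>y\<close> and midpoint \<open>m\<close>, \<open>F m\<close> is the gap
in the squared Minkowski form of the two-point inequality, with \<open>v\<close> in the role of
\<open>b y\<close>, and \<open>F' m / 4 = 2 * (m - y) + (b * b')(2 * m - y) - (b * b')(m) - (b m -
v) * b' m\<close>. Where \<open>b' m \<le> 0\<close>, the growth of \<open>b * b'\<close>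
compensates the last term, by the tangent bound \<open>falling\<close>. Where \<open>b' m >
0\<close>, this fails by at most \<open>e * b' m\<close>; since \<open>b' m \<le> 187/1000 - 187/50
* (m - 1/2)\<close>, this only concerns \<open>m \<le> 11/20\<close>, and the total loss is at most
\<open>4 * e * 187/40000\<close>. The parameter \<open>e\<close> measures how far \<open>v\<close>
lies below the line of slope \<open>187/1000\<close>: it is \<open>0\<close> for \<open>y \<ge>
1/2\<close> and of order \<open>(1/2 - y)\<^sup>2\<close> for \<open>y < 1/2\<close>.\<close>

lemma minkowski_gap_nonneg:
  fixes y v e m0 m :: real
  defines "F \<equiv> \<lambda>m. 4 * (m - y)\<^sup>2 + (right_profile (2 * m - y))\<^sup>2 - (2 * right_profile m - v)\<^sup>2"
  assumes "y \<le> 1" "1/2 \<le> m0" "y \<le> m0" "0 \<le> e"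
    and falling: "\<And>m. \<lbrakk>m0 \<le> m; m \<le> 1; right_slope m \<le> 0\<rbrakk> \<Longrightarrow> v \<le> right_profile m + right_slope m * (y - m)"
    and rising: "\<And>m. \<lbrakk>m0 \<le> m; m \<le> 1; 0 < right_slope m\<rbrakk> \<Longrightarrow> right_profile m - v \<le> 187/1000 * (m - y) + e"
    and start: "4 * e * (187/40000) \<le> F m0"
    and m: "m0 \<le> m" "2 * m - y \<le> 1"
  shows "0 \<le> F m"
proof -
  define F' where "F' = (\<lambda>m. 4 * (2 * (m - y) + right_profile (2 * m - y) * right_slope (2 * m - y)
    - right_profile m * right_slope m - (right_profile m - v) * right_slope m))"
  have D: "(F has_real_derivative F' m) (at m)" if "2 * m - y < 1" "m < 1" for m
  proof -
    have "((\<lambda>m. right_profile (2 * m - y)) has_real_derivative right_slope (2 * m - y) * 2) (at m)"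
      by (rule DERIV_chain'[where f = "\<lambda>m. 2 * m - y" and g = right_profile, THEN DERIV_cong])
        (auto intro!: derivative_eq_intros DERIV_right_profile that)
    note this [derivative_intros] and DERIV_right_profile[OF that(2), derivative_intros]
    show ?thesis
      unfolding F_def F'_def by (rule derivative_eq_intros refl)+ (simp add: algebra_simps)
  qed
  have cF: "continuous_on S F" for S
    unfolding F_def by (intro continuous_intros)
  have le1: "2 * m - y \<le> 1 \<Longrightarrow> m \<le> 1" for m using \<open>y \<le> 1\<close> by linarith
  have F'_falling: "0 \<le> F' m" if m: "m0 \<le> m" "2 * m - y \<le> 1" and neg: "right_slope m \<le> 0" for m
  proof -
    have "((right_slope m)\<^sup>2 - 2) * ((2 * m - y) - m) \<le> right_profile (2 * m - y) * right_slope (2 * m - y) - right_profile m * right_slope m"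
      using m assms(2-4) neg by (intro profile_slope_growth_falling) auto
    moreover have "(right_profile m - v) * right_slope m \<le> (right_slope m * (m - y)) * right_slope m"
      using falling[OF m(1) le1[OF m(2)] neg] neg
      by (intro mult_right_mono_neg) (auto simp: algebra_simps)
    ultimately show ?thesis unfolding F'_def by (simp add: algebra_simps power2_eq_square)
  qed
  have F'_rising: "- (4 * e * right_slope m) \<le> F' m"
    if m: "m0 \<le> m" "2 * m - y \<le> 1" and pos: "0 < right_slope m" for m
  proof -
    have r: "right_slope m \<le> 187/1000"
      using right_slope_antimono[of "1/2" m] right_slope_half m le1[OF m(2)] assms(3) by auto
    have "((187/1000)\<^sup>2 - 2) * ((2 * m - y) - m) \<le> right_profile (2 * m - y) * right_slope (2 * m - y) - right_profile m * right_slope m"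
      using m assms(2-4) by (intro profile_slope_growth_rising) auto
    moreover have "(right_profile m - v) * right_slope m \<le> (187/1000 * (m - y) + e) * right_slope m"
      using rising[OF m(1) le1[OF m(2)] pos] pos by (intro mult_right_mono) auto
    moreover have "187/1000 * (m - y) * right_slope m \<le> 187/1000 * (m - y) * (187/1000)"
      using r m assms(4) by (intro mult_left_mono) auto
    moreover have "(187/1000 * (m - y) + e) * right_slope m = 187/1000 * (m - y) * right_slope m + e * right_slope m"
      "((187/1000)\<^sup>2 - 2) * ((2 * m - y) - m) = 187/1000 * (m - y) * (187/1000) - 2 * (m - y)"
      by algebra+
    moreover have "- (4 * E) \<le> 4 * (2 * z + a - b - c)"
      if "p \<le> a - b" "c \<le> q" "u \<le> t" "q = u + E" "p = t - 2 * z" for a b c p q t u z E :: real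
      using that by argo
    ultimately show ?thesis unfolding F'_def mult.assoc[of 4 e] by blast
  qed
  \<comment> \<open>An antiderivative of the bound for the slope, which vanishes at \<open>m = 11/20\<close>.\<close>
  define \<phi> where "\<phi> = (\<lambda>m::real. 187/1000 * (m - 1/2) - 187/100 * (m - 1/2)\<^sup>2)"
  have \<phi>: "0 \<le> \<phi> t" "\<phi> t \<le> 187/40000" if "1/2 \<le> t" "t \<le> 11/20" for t
  proof -
    have "\<phi> t = 187/100 * ((t - 1/2) * (3/5 - t))" by (simp add: \<phi>_def field_simps power2_eq_square)
    moreover have "0 \<le> (t - 1/2) * (3/5 - t)" using that by (intro mult_nonneg_nonneg) auto
    ultimately show "0 \<le> \<phi> t" by simp
    have "187/40000 - \<phi> t = 187/100 * (t - 11/20)\<^sup>2" by (simp add: \<phi>_def field_simps power2_eq_square)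
    also have "0 \<le> \<dots>" by simp
    finally show "\<phi> t \<le> 187/40000" by simp
  qed
  have early: "0 \<le> F m" if m: "m0 \<le> m" "2 * m - y \<le> 1" "m \<le> 11/20" for m
  proof -
    have "F m0 + 4 * e * \<phi> m0 \<le> F m + 4 * e * \<phi> m"
    proof (rule DERIV_nonneg_imp_increasing_open[OF m(1)])
      fix t assume t: "m0 < t" "t < m"
      then have t1: "2 * t - y < 1" "t < 1" using m by auto
      have "((\<lambda>m. F m + 4 * e * \<phi> m) has_real_derivative
          F' t + 4 * e * (187/1000 - 187/50 * (t - 1/2))) (at t)"
        unfolding \<phi>_def by (rule derivative_eq_intros D[OF t1] refl)+ (simp add: field_simps)
      moreover have "0 \<le> F' t + 4 * e * (187/1000 - 187/50 * (t - 1/2))"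
      proof (cases "right_slope t \<le> 0")
        case True
        have "0 \<le> 4 * e * (187/1000 - 187/50 * (t - 1/2))"
          using t m \<open>0 \<le> e\<close> by (intro mult_nonneg_nonneg) auto
        with F'_falling[of t] t t1 True show ?thesis by linarith
      next
        case False
        have "right_slope t \<le> 187/1000 - 187/50 * (t - 1/2)"
          using right_slope_decreasing[of "1/2" t] right_slope_half t t1 assms(3) by auto
        then have "4 * e * right_slope t \<le> 4 * e * (187/1000 - 187/50 * (t - 1/2))"
          using \<open>0 \<le> e\<close> by (intro mult_left_mono) auto
        with F'_rising[of t] t t1 False show ?thesis by linarith
      qed
      ultimately show "\<exists>z. ((\<lambda>m. F m + 4 * e * \<phi> m) has_real_derivative z) (at t) \<and> 0 \<le> z" by blast
    qed (use cF in \<open>auto simp: \<phi>_def intro!: continuous_intros\<close>)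
    moreover have "4 * e * \<phi> m \<le> 4 * e * (187/40000)" "0 \<le> 4 * e * \<phi> m0"
      using mult_left_mono[OF \<phi>(2)[of m], of "4 * e"] \<phi>(1)[of m0] m assms(3) \<open>0 \<le> e\<close> by auto
    ultimately show ?thesis using start by linarith
  qed
  have late: "F a \<le> F m" if a: "m0 \<le> a" "11/20 \<le> a" "a \<le> m" "2 * m - y \<le> 1" for a m
  proof (rule DERIV_nonneg_imp_increasing_open[OF a(3)])
    fix t assume t: "a < t" "t < m"
    then have t1: "2 * t - y < 1" "t < 1" using a le1[OF a(4)] by auto
    have "right_slope t \<le> 187/1000 - 187/50 * (t - 1/2)"
      using right_slope_decreasing[of "1/2" t] right_slope_half t t1 a by auto
    also have "\<dots> \<le> 0" using t a by simp
    finally have "0 \<le> F' t" using F'_falling[of t] t t1 a by auto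
    then show "\<exists>z. (F has_real_derivative z) (at t) \<and> 0 \<le> z" using D[OF t1] by blast
  qed (rule cF)
  have "0 \<le> F m0" using start \<open>0 \<le> e\<close> by (intro order_trans[OF _ start]) auto
  then show ?thesis
    using early[OF m] early[of "11/20"] late[of m0 m] late[of "11/20" m] m by linarith
qed

section \<open>Pointwise bounds for the profile\<close>

lemma left_profile_half: "left_profile (1/2) = 1/2"
  by (simp add: left_profile_def)

lemma left_profile_vertex: "left_profile x = 1/2 - 187/1000 * (1/2 - x) - 813/500 * (1/2 - x)\<^sup>2"
  by (simp add: left_profile_def field_simps power2_eq_square)

text \<open>For a quadratic the second difference is constant; the right-hand side may be used with
\<open>x > 1/2\<close> as well, as long as \<open>y\<close> and the midpoint are at most
\<open>1/2\<close>.\<close>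

lemma left_profile_midpoint: "2 * left_profile ((x + y) / 2) - left_profile y = left_profile x + 813/1000 * (x - y)\<^sup>2"
  by (simp add: left_profile_def field_simps power2_eq_square)

lemma left_profile_le_half:
  assumes "x \<le> 1/2" shows "left_profile x \<le> 1/2"
proof -
  have "0 \<le> 187/1000 * (1/2 - x) + 813/500 * (1/2 - x)\<^sup>2" using assms by simp
  then show ?thesis unfolding left_profile_vertex by linarith
qed

lemma profile_right: "1/2 \<le> x \<Longrightarrow> profile x = right_profile x"
  by (cases "x = 1/2") (simp_all only: profile_def right_profile_half left_profile_half, auto)

lemma corner_root_cases:
  assumes "1/2 \<le> x" "x \<le> 1"
  obtains s where "0 \<le> s" "s \<le> 1" "x = 1 - s\<^sup>2 / 2" "corner_root x = s" "right_profile x = s\<^sup>2 * right_factor s"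
proof (rule that)
  show "x = 1 - (corner_root x)\<^sup>2 / 2" using corner_root_sq[of x] assms by (simp add: field_simps)
  show "right_profile x = (corner_root x)\<^sup>2 * right_factor (corner_root x)" using corner_root_sq[of x] assms by (simp add: right_profile_def)
qed (use corner_root_bounds[OF assms] in auto)

text \<open>The linear bound of the two-point inequality at \<open>y = 0\<close>, divided by
\<open>s\<^sup>2\<close>.\<close>

lemma right_factor_lower:
  assumes "0 \<le> s" "s \<le> 1"
  shows "813/2000 * (1 - s\<^sup>2 / 2) \<le> 2071/5000 * right_factor s"
proof -
  have "0 \<le> 2071/5000 * right_factor s - 813/2000 * (1 - s\<^sup>2 / 2)"
  proof (rule nonneg_by_bernstein)
    show "(2071/5000 * right_factor s - 813/2000 * (1 - s\<^sup>2 / 2)) * 5000000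
        = bernstein [2076364, 1610762, 483527, 19250] s (1 - s)"
      by (simp add: right_factor_def field_simps) algebra
  qed (use assms in auto)
  then show ?thesis by simp
qed

text \<open>The linear bound of the two-point inequality on the line \<open>x + y = 1\<close> near
the corner \<open>(1, 0)\<close>, divided by \<open>1 - x = s\<^sup>2 / 2\<close>.\<close>

lemma right_factor_lower_corner:
  assumes "0 \<le> s" "s\<^sup>2 \<le> 1/2"
  shows "0 \<le> 2071/2500 * right_factor s - 187/1000 - 813/1000 * s\<^sup>2"
proof -
  have "s\<^sup>2 \<le> (71/100)\<^sup>2" using assms(2) by (rule order_trans) (simp add: power2_eq_square)
  then have "s \<le> 71/100" by (rule power2_le_imp_le) simp
  show ?thesis
  proof (rule nonneg_by_bernstein)
    show "(2071/2500 * right_factor s - 187/1000 - 813/1000 * s\<^sup>2) * 894777500000000000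
        = bernstein [3641364000000, 7645077700000, 4589049514500, 252521891731] (100 * s) (71 - 100 * s)"
      by (simp add: right_factor_def field_simps) algebra
  qed (use assms \<open>s \<le> 71/100\<close> in auto)
qed

lemma right_profile_nonneg:
  assumes "1/2 \<le> x" "x \<le> 1" shows "0 \<le> right_profile x"
proof -
  obtain s where s: "0 \<le> s" "s \<le> 1" "right_profile x = s\<^sup>2 * right_factor s" using corner_root_cases[OF assms] by metis
  have "s\<^sup>2 \<le> 1" using s by (simp add: power_le_one)
  then have "0 \<le> right_factor s" using right_factor_lower[OF s(1,2)] by simp
  then show ?thesis using s by simp
qed

lemma profile_nonneg:
  assumes "0 \<le> x" "x \<le> 1" shows "0 \<le> profile x"
  using assms right_profile_nonneg[of x] by (auto simp: profile_def left_profile_def)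

text \<open>The parabola is the least value of \<open>b x\<close> for which \<open>b x + b (1 - x)
\<ge> 4 * x * (1 - x)\<close>. Both functions agree to first order at \<open>x = 1/2\<close> and
vanish at \<open>x = 1\<close>, which explains the factors of the difference.\<close>

lemma right_profile_ge_parabola:
  assumes "1/2 \<le> x" "x \<le> 1"
  shows "1/2 + 187/1000 * (x - 1/2) - 1187/500 * (x - 1/2)\<^sup>2 \<le> right_profile x"
proof -
  obtain s where s: "0 \<le> s" "s \<le> 1" "x = 1 - s\<^sup>2 / 2" "right_profile x = s\<^sup>2 * right_factor s" using corner_root_cases[OF assms] by metis
  have "right_profile x - (1/2 + 187/1000 * (x - 1/2) - 1187/500 * (x - 1/2)\<^sup>2)
      = s\<^sup>2 * (1 - s)\<^sup>2 * (1781/2000 - 449/1000 * s)"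
    unfolding s(4) unfolding s(3) by (simp add: right_factor_def field_simps) algebra
  also have "0 \<le> \<dots>" using s by auto
  finally show ?thesis by simp
qed

text \<open>The parabolas of this lemma and the next one lie closer to the profile, on \<open>[1/2,
3/4]\<close> and \<open>[1/2, 41/50]\<close>; the factor \<open>(1 - s)\<^sup>2\<close> of the
difference comes from the common tangent at \<open>x = 1/2\<close>.\<close>

lemma right_profile_ge_parabola_mid:
  assumes "1/2 \<le> x" "x \<le> 3/4"
  shows "1/2 + 187/1000 * (x - 1/2) - 2 * (x - 1/2)\<^sup>2 \<le> right_profile x"
proof -
  obtain s where s: "0 \<le> s" "s \<le> 1" "x = 1 - s\<^sup>2 / 2" "right_profile x = s\<^sup>2 * right_factor s" using corner_root_cases[of x] assms by force
  have "(7/10)\<^sup>2 \<le> s\<^sup>2" using s(3) assms by (simp add: power2_eq_square)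
  then have "7/10 \<le> s" using s(1) by (rule power2_le_imp_le)
  have "0 \<le> -187/2000 - 187/1000 * s + 797/1000 * s\<^sup>2 - 449/1000 * s^3"
  proof (rule nonneg_by_bernstein)
    show "(-187/2000 - 187/1000 * s + 797/1000 * s\<^sup>2 - 449/1000 * s^3) * 3000000
        = bernstein [1347, 13000, 20500, 7500] (10 * s - 7) (10 - 10 * s)"
      by (simp add: field_simps) algebra
  qed (use s \<open>7/10 \<le> s\<close> in auto)
  moreover have "right_profile x - (1/2 + 187/1000 * (x - 1/2) - 2 * (x - 1/2)\<^sup>2)
      = (1 - s)\<^sup>2 * (-187/2000 - 187/1000 * s + 797/1000 * s\<^sup>2 - 449/1000 * s^3)"
    unfolding s(4) unfolding s(3) by (simp add: right_factor_def field_simps) algebra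
  ultimately have "0 \<le> right_profile x - (1/2 + 187/1000 * (x - 1/2) - 2 * (x - 1/2)\<^sup>2)" by simp
  then show ?thesis by simp
qed

lemma right_profile_ge_parabola_wide:
  assumes "1/2 \<le> x" "x \<le> 41/50"
  shows "1/2 + 187/1000 * (x - 1/2) - 409/200 * (x - 1/2)\<^sup>2 \<le> right_profile x"
proof -
  obtain s where s: "0 \<le> s" "s \<le> 1" "x = 1 - s\<^sup>2 / 2" "right_profile x = s\<^sup>2 * right_factor s" using corner_root_cases[of x] assms by force
  have "(3/5)\<^sup>2 \<le> s\<^sup>2" using s(3) assms by (simp add: power2_eq_square)
  then have "3/5 \<le> s" using s(1) by (rule power2_le_imp_le)
  have "0 \<le> -329/4000 - 329/2000 * s + 3233/4000 * s\<^sup>2 - 449/1000 * s^3"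
  proof (rule nonneg_by_bernstein)
    show "(-329/4000 - 329/2000 * s + 3233/4000 * s\<^sup>2 - 449/1000 * s^3) * 2000000
        = bernstein [3259, 41825, 73875, 28125] (5 * s - 3) (5 - 5 * s)"
      by (simp add: field_simps) algebra
  qed (use s \<open>3/5 \<le> s\<close> in auto)
  moreover have "right_profile x - (1/2 + 187/1000 * (x - 1/2) - 409/200 * (x - 1/2)\<^sup>2)
      = (1 - s)\<^sup>2 * (-329/4000 - 329/2000 * s + 3233/4000 * s\<^sup>2 - 449/1000 * s^3)"
    unfolding s(4) unfolding s(3) by (simp add: right_factor_def field_simps) algebra
  ultimately have "0 \<le> right_profile x - (1/2 + 187/1000 * (x - 1/2) - 409/200 * (x - 1/2)\<^sup>2)" by simp
  then show ?thesis by simp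
qed

text \<open>The squared Minkowski bound for \<open>x = 1/2 + d\<close> and \<open>y = 1/2 -
d\<close>. The surplus \<open>61/2000 * d\<^sup>2\<close> pays for the loss in
\<open>minkowski_gap_nonneg\<close> with \<open>e = 813/500 * d\<^sup>2\<close>, since \<open>4 *
813/500 * 187/40000 < 61/2000\<close>.\<close>

lemma antidiagonal_gap:
  assumes "0 \<le> d" "d \<le> 8/25"
  shows "61/2000 * d\<^sup>2 \<le> 4 * d\<^sup>2 + (right_profile (1/2 + d))\<^sup>2 - (1/2 + 187/1000 * d + 813/500 * d\<^sup>2)\<^sup>2"
proof -
  let ?A = "1/2 + 187/1000 * d"
  have "d\<^sup>2 \<le> (8/25)\<^sup>2" using assms by (intro power_mono)
  then have "0 \<le> ?A - 409/200 * d\<^sup>2" using assms by (simp add: power2_eq_square)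
  moreover have "?A - 409/200 * d\<^sup>2 \<le> right_profile (1/2 + d)"
    using right_profile_ge_parabola_wide[of "1/2 + d"] assms by simp
  ultimately have R: "(?A - 409/200 * d\<^sup>2)\<^sup>2 \<le> (right_profile (1/2 + d))\<^sup>2"
    by (rule power_mono[rotated])
  have "0 \<le> d\<^sup>2 * (7939/2000 - 3671/1000 * (1 + 187/500 * d - 419/1000 * d\<^sup>2))"
  proof (intro mult_nonneg_nonneg)
    \<comment> \<open>The Taylor expansion at the right end \<open>d = 8/25\<close>.\<close>
    have "0 \<le> 3671/1000 * (419/1000 * (8/25 - d)\<^sup>2 + 2646/25000 * (8/25 - d)) + 166611776/10000000000"
      using assms by (intro add_nonneg_nonneg mult_nonneg_nonneg) auto
    also have "\<dots> = 7939/2000 - 3671/1000 * (1 + 187/500 * d - 419/1000 * d\<^sup>2)"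
      by (simp add: field_simps power2_eq_square)
    finally show "0 \<le> 7939/2000 - 3671/1000 * (1 + 187/500 * d - 419/1000 * d\<^sup>2)" .
  qed simp
  also have "\<dots> = 4 * d\<^sup>2 + (?A - 409/200 * d\<^sup>2)\<^sup>2 - (?A + 813/500 * d\<^sup>2)\<^sup>2 - 61/2000 * d\<^sup>2"
    by algebra
  finally show ?thesis using R by linarith
qed

lemma concave_quadratic_between:
  fixes a b c u v t :: real
  assumes "a \<le> 0" "u \<le> t" "t \<le> v" "0 \<le> a * u\<^sup>2 + b * u + c" "0 \<le> a * v\<^sup>2 + b * v + c"
  shows "0 \<le> a * t\<^sup>2 + b * t + c"
proof (cases "u = v")
  case False
  then have "0 < v - u" using assms by simp
  have "(v - u) * (a * t\<^sup>2 + b * t + c) = (v - t) * (a * u\<^sup>2 + b * u + c)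
      + (t - u) * (a * v\<^sup>2 + b * v + c) + (- a) * ((t - u) * (v - t) * (v - u))"
    by algebra
  also have "0 \<le> \<dots>"
  proof (intro add_nonneg_nonneg)
    show "0 \<le> (v - t) * (a * u\<^sup>2 + b * u + c)" "0 \<le> (t - u) * (a * v\<^sup>2 + b * v + c)"
      using assms by (auto intro: mult_nonneg_nonneg simp del: zero_le_mult_iff)
    show "0 \<le> - a * ((t - u) * (v - t) * (v - u))"
      using assms by (intro mult_nonneg_nonneg) auto
  qed
  finally show ?thesis using \<open>0 < v - u\<close> by (simp add: zero_le_mult_iff)
qed (use assms in auto)

text \<open>At distance \<open>x - y = 1/2\<close> the two lower bounds nearly coincide, because
\<open>b x\<close> is close to \<open>1/2\<close>: this is where the proof changes from Minkowski's
inequality to the linear bound, so both are needed here.\<close>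

lemma middle_gap_minkowski:
  assumes "1/2 \<le> x" "x \<le> 3/4"
  shows "(left_profile x + 813/4000)\<^sup>2 \<le> 1/4 + (right_profile x)\<^sup>2"
proof -
  define d where "d = x - 1/2"
  have d: "0 \<le> d" "d \<le> 1/4" using assms by (auto simp: d_def)
  let ?A = "1/2 + 187/1000 * d"
  have "d\<^sup>2 \<le> (1/4)\<^sup>2" using d by (intro power_mono)
  then have "0 \<le> ?A - 2 * d\<^sup>2" using d by (simp add: power2_eq_square)
  then have R: "(?A - 2 * d\<^sup>2)\<^sup>2 \<le> (right_profile x)\<^sup>2"
    using right_profile_ge_parabola_mid[OF assms] by (intro power_mono) (auto simp: d_def)
  have left_profile: "left_profile x = ?A - 813/500 * d\<^sup>2"
    unfolding left_profile_vertex d_def by (simp add: field_simps power2_eq_square)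
  let ?g = "1/4 - (813/4000 + 187/500 * d\<^sup>2) * (4813/4000 + 187/500 * d - 1813/500 * d\<^sup>2)"
  have "0 \<le> ?g"
  proof (cases "d \<le> 1/8")
    case True
    show ?thesis
    proof (rule nonneg_by_bernstein)
      show "?g * 1024000000 = bernstein [5569984, 12549952, 8821456, 1993240, 490783] (8 * d) (1 - 8 * d)"
        by (simp add: field_simps) algebra
    qed (use d True in auto)
  next
    case False
    show ?thesis
    proof (rule nonneg_by_bernstein)
      show "?g * 16384000000 = bernstein [490783, 1933024, 8640808, 14522048, 7662512] (16 * d - 2) (4 - 16 * d)"
        by (simp add: field_simps) algebra
    qed (use d False in auto)
  qed
  also have "?g = 1/4 + (?A - 2 * d\<^sup>2)\<^sup>2 - (?A - 813/500 * d\<^sup>2 + 813/4000)\<^sup>2"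
    by algebra
  finally show ?thesis using R unfolding left_profile by linarith
qed

lemma middle_gap_linear:
  assumes "1/2 \<le> x" "x \<le> 3/4"
  shows "left_profile x + 813/4000 \<le> 1/2 + 2071/5000 * right_profile x"
proof -
  define d where "d = x - 1/2"
  have left_profile: "left_profile x = 1/2 + 187/1000 * d - 813/500 * d\<^sup>2"
    unfolding left_profile_vertex d_def by (simp add: field_simps power2_eq_square)
  have right_profile: "1/2 + 187/1000 * d - 2 * d\<^sup>2 \<le> right_profile x"
    using right_profile_ge_parabola_mid[OF assms] by (simp add: d_def)
  \<comment> \<open>Completing the square in the difference, after inserting the parabola for \<open>right_profile x\<close>.\<close>
  have "0 \<le> 7976/10000 * (d - 547723/7976000)\<^sup>2" by simp
  then have "0 \<le> 1/2 + 2071/5000 * (1/2 + 187/1000 * d - 2 * d\<^sup>2) - (1/2 + 187/1000 * d - 813/500 * d\<^sup>2) - 813/4000"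
    by (simp add: field_simps power2_eq_square)
  then show ?thesis using right_profile left_profile by (simp add: field_simps)
qed

lemma corner_gap:
  assumes "3/4 \<le> x" "x \<le> 1"
  shows "0 \<le> 1 - 2 * (1 - x) + 2071/5000 * right_profile x + left_profile (1 - x) - 1"
proof -
  obtain s where s: "0 \<le> s" "s \<le> 1" "x = 1 - s\<^sup>2 / 2" "right_profile x = s\<^sup>2 * right_factor s" using corner_root_cases[of x] assms by force
  have "0 \<le> s\<^sup>2 / 2 * (2071/2500 * right_factor s - 187/1000 - 813/1000 * s\<^sup>2)"
    using s assms by (intro mult_nonneg_nonneg right_factor_lower_corner) auto
  also have "\<dots> = 1 - 2 * (1 - x) + 2071/5000 * right_profile x + left_profile (1 - x) - 1"
    unfolding s(4) unfolding s(3) left_profile_def by (simp add: field_simps) 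
  finally show ?thesis .
qed

lemma bottom_gap:
  assumes "1/2 \<le> x" "x \<le> 1"
  shows "0 \<le> x + 2071/5000 * right_profile x - left_profile x - 813/1000 * x\<^sup>2"
proof -
  obtain s where s: "0 \<le> s" "s \<le> 1" "x = 1 - s\<^sup>2 / 2" "right_profile x = s\<^sup>2 * right_factor s" using corner_root_cases[OF assms] by metis
  have "0 \<le> s\<^sup>2 * (2071/5000 * right_factor s - 813/2000 * (1 - s\<^sup>2 / 2))"
    using right_factor_lower[OF s(1,2)] by simp
  also have "\<dots> = x + 2071/5000 * right_profile x - left_profile x - 813/1000 * x\<^sup>2"
    unfolding s(4) unfolding s(3) left_profile_def by (simp add: field_simps power2_eq_square)
  finally show ?thesis .
qed

section \<open>The two-point inequality\<close>

abbreviation two_point :: "real \<Rightarrow> real \<Rightarrow> bool" where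
  "two_point x y \<equiv> 2 * profile ((x + y) / 2) \<le>
    profile y + max (sqrt ((x - y)\<^sup>2 + (profile x)\<^sup>2)) ((x - y) + 2071/5000 * profile x)"

lemma two_point_minkowski:
  "(2 * profile ((x + y) / 2) - profile y)\<^sup>2 \<le> (x - y)\<^sup>2 + (profile x)\<^sup>2 \<Longrightarrow> two_point x y"
  using real_le_rsqrt[of "2 * profile ((x + y) / 2) - profile y" "(x - y)\<^sup>2 + (profile x)\<^sup>2"] by linarith

lemma two_point_linear:
  "2 * profile ((x + y) / 2) - profile y \<le> (x - y) + 2071/5000 * profile x \<Longrightarrow> two_point x y"
  by linarith

lemma two_point_lower:
  assumes "0 \<le> y" "y \<le> x" "x \<le> 1/2"
  shows "two_point x y"
proof (rule two_point_minkowski)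
  have "0 \<le> (x - y)\<^sup>2 * (1 - 813/500 * left_profile x - (813/1000)\<^sup>2 * (x - y)\<^sup>2)"
  proof (intro mult_nonneg_nonneg)
    have "(x - y)\<^sup>2 \<le> (1/2)\<^sup>2" using assms by (intro power_mono) auto
    then show "0 \<le> 1 - 813/500 * left_profile x - (813/1000)\<^sup>2 * (x - y)\<^sup>2"
      using left_profile_le_half[OF assms(3)] by (simp add: power2_eq_square)
  qed simp
  also have "\<dots> = (x - y)\<^sup>2 + (left_profile x)\<^sup>2 - (left_profile x + 813/1000 * (x - y)\<^sup>2)\<^sup>2" by algebra
  finally show "(2 * profile ((x + y) / 2) - profile y)\<^sup>2 \<le> (x - y)\<^sup>2 + (profile x)\<^sup>2"
    using assms left_profile_midpoint[of x y] by (simp add: profile_def)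
qed

text \<open>For fixed \<open>x\<close>, the Minkowski gap is a concave quadratic in \<open>(x -
y)\<^sup>2\<close> and the linear gap is one in \<open>x - y\<close>. Minkowski's inequality serves
for \<open>2 * x - 1 \<le> x - y \<le> 1/2\<close> and the linear bound for the remaining distances
up to \<open>x\<close>.\<close>

lemma two_point_straddling:
  assumes "0 \<le> y" "1/2 < x" "x + y \<le> 1"
  shows "two_point x y"
proof -
  define d where "d = x - y"
  have d: "2 * x - 1 \<le> d" "d \<le> x" "0 \<le> 2 * x - 1" using assms by (auto simp: d_def)
  have mid: "2 * profile ((x + y) / 2) - profile y = left_profile x + 813/1000 * d\<^sup>2" and Bx: "profile x = right_profile x"
    using left_profile_midpoint[of x y] assms by (auto simp: profile_def d_def)
  show ?thesis
  proof (cases "x \<le> 3/4 \<and> d \<le> 1/2")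
    case True
    have "0 \<le> - (813/1000)\<^sup>2 * (d\<^sup>2)\<^sup>2 + (1 - 813/500 * left_profile x) * d\<^sup>2 + ((right_profile x)\<^sup>2 - (left_profile x)\<^sup>2)"
    proof (rule concave_quadratic_between)
      show "(2 * x - 1)\<^sup>2 \<le> d\<^sup>2" "d\<^sup>2 \<le> 1/4"
        using d True power_mono[of "2 * x - 1" d 2] power_mono[of d "1/2" 2] by (auto simp: power2_eq_square)
      have "left_profile x + 813/1000 * (2 * x - 1)\<^sup>2 = 1/2 + 187/1000 * (x - 1/2) + 813/500 * (x - 1/2)\<^sup>2"
        by (simp add: left_profile_def field_simps power2_eq_square)
      moreover have "0 \<le> 4 * (x - 1/2)\<^sup>2 + (right_profile x)\<^sup>2 - (1/2 + 187/1000 * (x - 1/2) + 813/500 * (x - 1/2)\<^sup>2)\<^sup>2"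
        using order_trans[OF _ antidiagonal_gap[of "x - 1/2"], of 0] assms True by simp
      moreover have "4 * (x - 1/2)\<^sup>2 = (2 * x - 1)\<^sup>2" by algebra
      ultimately have "0 \<le> (2 * x - 1)\<^sup>2 + (right_profile x)\<^sup>2 - (left_profile x + 813/1000 * (2 * x - 1)\<^sup>2)\<^sup>2" by simp
      then show "0 \<le> - (813/1000)\<^sup>2 * ((2 * x - 1)\<^sup>2)\<^sup>2 + (1 - 813/500 * left_profile x) * (2 * x - 1)\<^sup>2 + ((right_profile x)\<^sup>2 - (left_profile x)\<^sup>2)"
        by (rule order_trans) (rule eq_refl, algebra)
      show "0 \<le> - (813/1000)\<^sup>2 * (1/4)\<^sup>2 + (1 - 813/500 * left_profile x) * (1/4) + ((right_profile x)\<^sup>2 - (left_profile x)\<^sup>2)"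
        using middle_gap_minkowski[of x] assms True by (simp add: power2_eq_square field_simps)
    qed simp
    also have "\<dots> = d\<^sup>2 + (right_profile x)\<^sup>2 - (left_profile x + 813/1000 * d\<^sup>2)\<^sup>2" by algebra
    finally show ?thesis
      using mid Bx by (intro two_point_minkowski) (simp add: d_def)
  next
    case False
    \<comment> \<open>The smallest distance in the current case: \<open>x + y \<le> 1\<close> forces \<open>x - y \<ge> 2 * x - 1\<close>.\<close>
    define u where "u = (if x \<le> 3/4 then 1/2 else 2 * x - 1)"
    have "0 \<le> - (813/1000) * d\<^sup>2 + 1 * d + (2071/5000 * right_profile x - left_profile x)"
    proof (rule concave_quadratic_between)
      show "u \<le> d" "d \<le> x" using False d by (auto simp: u_def)
      show "0 \<le> - (813/1000) * x\<^sup>2 + 1 * x + (2071/5000 * right_profile x - left_profile x)"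
        using bottom_gap[of x] assms by simp
      show "0 \<le> - (813/1000) * u\<^sup>2 + 1 * u + (2071/5000 * right_profile x - left_profile x)"
      proof (cases "x \<le> 3/4")
        case True
        then show ?thesis using middle_gap_linear[of x] assms by (simp add: u_def power2_eq_square)
      next
        case False
        have "left_profile x + 813/1000 * (2 * x - 1)\<^sup>2 = 1 - left_profile (1 - x)"
          by (simp add: left_profile_def field_simps power2_eq_square)
        then show ?thesis using corner_gap[of x] assms False by (simp add: u_def)
      qed
    qed simp
    then show ?thesis using mid Bx by (intro two_point_linear) (simp add: d_def)
  qed
qed

lemma two_point_upper:
  assumes "1/2 \<le> y" "y \<le> x" "x \<le> 1"
  shows "two_point x y"
proof (rule two_point_minkowski)
  have "0 \<le> 4 * ((x + y) / 2 - y)\<^sup>2 + (right_profile (2 * ((x + y) / 2) - y))\<^sup>2 - (2 * right_profile ((x + y) / 2) - right_profile y)\<^sup>2"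
  proof (rule minkowski_gap_nonneg[where y = y and v = "right_profile y" and e = 0 and ?m0.0 = y and m = "(x + y) / 2"])
    fix m assume m: "y \<le> m" "m \<le> 1"
    show "right_profile y \<le> right_profile m + right_slope m * (y - m)" using m assms by (intro right_profile_below_tangent) auto
    assume "0 < right_slope m"
    have "right_profile m \<le> right_profile y + right_slope y * (m - y)" using m assms by (intro right_profile_below_tangent) auto
    also have "right_slope y * (m - y) \<le> 187/1000 * (m - y)"
      using right_slope_antimono[of "1/2" y] right_slope_half m assms by (intro mult_right_mono) auto
    finally show "right_profile m - right_profile y \<le> 187/1000 * (m - y) + 0" by (simp add: field_simps)
  qed (use assms in \<open>auto simp: field_simps\<close>)
  also have "\<dots> = (x - y)\<^sup>2 + (right_profile x)\<^sup>2 - (2 * right_profile ((x + y) / 2) - right_profile y)\<^sup>2"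
    by (simp add: field_simps power2_eq_square)
  finally show "(2 * profile ((x + y) / 2) - profile y)\<^sup>2 \<le> (x - y)\<^sup>2 + (profile x)\<^sup>2"
    using assms by (simp add: profile_right)
qed

lemma right_profile_below_tangent_half:
  assumes "1/2 \<le> m" "m \<le> 1" shows "right_profile m \<le> 1/2 + 187/1000 * (m - 1/2)"
  using right_profile_below_tangent[of m "1/2"] assms right_profile_half right_slope_half by simp

text \<open>For \<open>y \<ge> 9/50\<close> the Minkowski gap is followed from \<open>m =
1/2\<close>, where it is given by \<open>antidiagonal_gap\<close>. Minkowski's inequality fails near
\<open>(1, 0)\<close>; there the linear bound is combined with the tangent of
\<open>right_profile\<close> at \<open>1/2\<close>, which reduces it to the line \<open>x + y =
1\<close>.\<close>

lemma two_point_crossing: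
  assumes "0 \<le> y" "y \<le> 1/2" "x \<le> 1" "1 \<le> x + y"
  shows "two_point x y"
proof -
  define m where "m = (x + y) / 2"
  have m: "1/2 \<le> m" "m \<le> 1" "2 * m = x + y" and x: "1/2 \<le> x" using assms by (auto simp: m_def)
  have profile: "profile m = right_profile m" "profile x = right_profile x" "profile y = left_profile y" using profile_right[OF m(1)] profile_right[OF x] assms by (auto simp: profile_def)
  show ?thesis
  proof (cases "9/50 \<le> y")
    case True
    have "0 \<le> 4 * (m - y)\<^sup>2 + (right_profile (2 * m - y))\<^sup>2 - (2 * right_profile m - left_profile y)\<^sup>2"
    proof (rule minkowski_gap_nonneg[where y = y and v = "left_profile y" and e = "813/500 * (1/2 - y)\<^sup>2" and ?m0.0 = "1/2" and m = m])
      fix m :: real assume m: "1/2 \<le> m" "m \<le> 1"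
      have "1/2 \<le> right_profile m + right_slope m * (1/2 - m)" using right_profile_below_tangent[of "1/2" m] m right_profile_half by simp
      moreover assume "right_slope m \<le> 0"
      then have "0 \<le> right_slope m * (y - 1/2)" using assms by (intro mult_nonpos_nonpos) auto
      ultimately show "left_profile y \<le> right_profile m + right_slope m * (y - m)"
        using left_profile_le_half[of y] assms by (simp add: algebra_simps)
    next
      fix m :: real assume m: "1/2 \<le> m" "m \<le> 1"
      show "right_profile m - left_profile y \<le> 187/1000 * (m - y) + 813/500 * (1/2 - y)\<^sup>2"
        using right_profile_below_tangent_half[OF m] unfolding left_profile_vertex by argo
    next
      have "4 * (813/500 * (1/2 - y)\<^sup>2) * (187/40000) \<le> 61/2000 * (1/2 - y)\<^sup>2" by simp
      also have "\<dots> \<le> 4 * (1/2 - y)\<^sup>2 + (right_profile (1/2 + (1/2 - y)))\<^sup>2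
          - (1/2 + 187/1000 * (1/2 - y) + 813/500 * (1/2 - y)\<^sup>2)\<^sup>2"
        using assms True by (intro antidiagonal_gap) auto
      also have "\<dots> = 4 * (1/2 - y)\<^sup>2 + (right_profile (2 * (1/2) - y))\<^sup>2 - (2 * right_profile (1/2) - left_profile y)\<^sup>2"
      proof -
        have "1/2 + (1/2 - y) = 2 * (1/2) - y"
          "1/2 + 187/1000 * (1/2 - y) + 813/500 * (1/2 - y)\<^sup>2 = 2 * right_profile (1/2) - left_profile y"
          unfolding right_profile_half left_profile_vertex by simp_all
        then show ?thesis by (simp only:)
      qed
      finally show "4 * (813/500 * (1/2 - y)\<^sup>2) * (187/40000)
          \<le> 4 * (1/2 - y)\<^sup>2 + (right_profile (2 * (1/2) - y))\<^sup>2 - (2 * right_profile (1/2) - left_profile y)\<^sup>2" .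
    qed (use assms m in auto)
    moreover have "4 * (m - y)\<^sup>2 = (x - y)\<^sup>2" "2 * m - y = x" using m by algebra+
    ultimately show ?thesis using profile by (intro two_point_minkowski) (simp add: m_def)
  next
    case False
    \<comment> \<open>The function \<open>t * (313/500 - 813/500 * t)\<close> increases from \<open>t = 1 - x\<close> to \<open>t = y\<close>, so \<open>y\<close> may be
      replaced by \<open>1 - x\<close>.\<close>
    have "0 \<le> (y - (1 - x)) * (313/500 - 813/500 * (y + (1 - x)))"
      using False assms by (intro mult_nonneg_nonneg) auto
    moreover have "0 \<le> 1 - 2 * (1 - x) + 2071/5000 * right_profile x + left_profile (1 - x) - 1"
      using False assms by (intro corner_gap) auto
    ultimately have "1 + 187/500 * (m - 1/2) - left_profile y \<le> (x - y) + 2071/5000 * right_profile x"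
      unfolding m_def left_profile_def by (simp add: field_simps)
    then show ?thesis
      using right_profile_below_tangent_half[OF m(1,2)] profile by (intro two_point_linear) (simp add: m_def)
  qed
qed

lemma two_point_inequality:
  assumes "0 \<le> y" "y \<le> x" "x \<le> 1"
  shows "two_point x y"
proof -
  consider "x \<le> 1/2" | "1/2 < x" "x + y \<le> 1" | "y \<le> 1/2" "1 \<le> x + y" | "1/2 \<le> y" by linarith
  then show ?thesis
  proof cases
    case 1 with assms show ?thesis by (intro two_point_lower)
  next
    case 2 with assms show ?thesis by (intro two_point_straddling)
  next
    case 3 with assms show ?thesis by (intro two_point_crossing)
  next
    case 4 with assms show ?thesis by (intro two_point_upper)
  qed
qed

lemma two_sided_bound:
  assumes "0 \<le> x" "x \<le> 1"
  shows "4 * x * (1 - x) \<le> profile x + profile (1 - x)"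
proof -
  have *: "4 * x * (1 - x) \<le> left_profile x + right_profile (1 - x)" if "0 \<le> x" "x \<le> 1/2" for x
    using right_profile_ge_parabola[of "1 - x"] that unfolding left_profile_def by (simp add: field_simps power2_eq_square)
  show ?thesis
  proof (cases "x \<le> 1/2")
    case True
    then show ?thesis using *[of x] assms profile_right[of "1 - x"] by (simp add: profile_def)
  next
    case False
    then show ?thesis using *[of "1 - x"] assms by (simp add: profile_def algebra_simps)
  qed
qed

section \<open>Induction over the cube\<close>

lemma finite_cube: "finite (cube n)"
  unfolding cube_def by (intro finite_PiE) auto

lemma cube_Suc:
  "cube (Suc n) = (\<lambda>x. x(Suc n := 0)) ` cube n \<union> (\<lambda>x. x(Suc n := 1)) ` cube n"
proof -
  have "{1..Suc n} = insert (Suc n) {1..n}" by auto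
  then show ?thesis unfolding cube_def by (auto simp: PiE_insert_eq image_iff)
qed

lemma inj_on_cube_upd: "inj_on (\<lambda>x. x(Suc n := j)) (cube n)"
proof (rule inj_onI)
  fix x y assume xy: "x \<in> cube n" "y \<in> cube n" and eq: "x(Suc n := j) = y(Suc n := j)"
  show "x = y"
  proof
    fix k
    show "x k = y k"
    proof (cases "k = Suc n")
      case True
      then show ?thesis using xy by (simp add: cube_def PiE_def extensional_def)
    next
      case False
      then show ?thesis using fun_cong[OF eq, of k] by simp
    qed
  qed
qed

lemma sum_cube_Suc:
  "(\<Sum>x\<in>cube (Suc n). g x) = (\<Sum>x\<in>cube n. g (x(Suc n := 0)) + g (x(Suc n := 1)))"
proof -
  have "(\<lambda>x. x(Suc n := 0)) ` cube n \<inter> (\<lambda>x. x(Suc n := 1)) ` cube n = {}"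
    by (auto dest: fun_cong[where x = "Suc n"])
  then show ?thesis
    unfolding cube_Suc
    by (subst sum.union_disjoint) (auto simp: finite_cube sum.reindex inj_on_cube_upd sum.distrib)
qed

lemma card_cube: "card (cube n) = 2 ^ n"
  unfolding cube_def by (simp add: card_PiE numeral_2_eq_2)

lemma flip_in_cube: "x \<in> cube n \<Longrightarrow> i \<in> {1..n} \<Longrightarrow> flip i x \<in> cube n"
  unfolding cube_def flip_def by (auto simp: PiE_iff extensional_def)

lemma sum_indicator_card: "finite X \<Longrightarrow> (\<Sum>x\<in>X. indicator D x) = real (card (X \<inter> D))"
  by (simp add: indicator_def of_bool_def sum.If_cases Int_def)

text \<open>At points \<open>x \<in> A\<close> this is the function \<open>h\<close> of the
introduction.\<close>

definition exits :: "nat \<Rightarrow> (nat \<Rightarrow> nat) set \<Rightarrow> (nat \<Rightarrow> nat) \<Rightarrow> nat" where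
  "exits n A x = card {i \<in> {1..n}. flip i x \<notin> A}"

definition slice :: "nat \<Rightarrow> nat \<Rightarrow> (nat \<Rightarrow> nat) set \<Rightarrow> (nat \<Rightarrow> nat) set" where
  "slice n j A = {x. x(Suc n := j) \<in> A}"

lemma exits_Suc:
  assumes "j \<in> {0, 1}"
  shows "exits (Suc n) A (x(Suc n := j)) = exits n (slice n j A) x + (if x \<in> slice n (1 - j) A then 0 else 1)"
proof -
  have "flip i (x(Suc n := j)) = (flip i x)(Suc n := j)" if "i \<in> {1..n}" for i
    using that by (auto simp: flip_def fun_eq_iff)
  moreover have "flip (Suc n) (x(Suc n := j)) = x(Suc n := 1 - j)"
    by (auto simp: flip_def)
  ultimately have "{i \<in> {1..Suc n}. flip i (x(Suc n := j)) \<notin> A}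
      = {i \<in> {1..n}. flip i x \<notin> slice n j A} \<union> (if x \<in> slice n (1 - j) A then {} else {Suc n})"
    by (auto simp: slice_def le_Suc_eq)
  then show ?thesis unfolding exits_def by (auto simp: card_insert_if)
qed

text \<open>The triangle inequality for the plane vectors \<open>(indicator D x, sqrt (h
x))\<close>, encoded as complex numbers.\<close>

lemma sum_sqrt_bump_minkowski:
  fixes h :: "'a \<Rightarrow> real"
  assumes "finite X" "\<And>x. x \<in> X \<Longrightarrow> 0 \<le> h x"
  shows "sqrt ((real (card (X \<inter> D)))\<^sup>2 + (\<Sum>x\<in>X. sqrt (h x))\<^sup>2) \<le> (\<Sum>x\<in>X. sqrt (h x + indicator D x))"
proof -
  let ?z = "\<lambda>x. Complex (indicator D x) (sqrt (h x))"
  have "cmod (\<Sum>x\<in>X. ?z x) \<le> (\<Sum>x\<in>X. cmod (?z x))" by (rule norm_sum)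
  moreover have "(\<Sum>x\<in>X. ?z x) = Complex (real (card (X \<inter> D))) (\<Sum>x\<in>X. sqrt (h x))"
    using assms(1) by (simp add: complex_eq_iff Re_sum Im_sum sum_indicator_card)
  moreover have "(\<Sum>x\<in>X. cmod (?z x)) = (\<Sum>x\<in>X. sqrt (h x + indicator D x))"
    using assms(2) by (intro sum.cong) (auto simp: cmod_def indicator_def)
  ultimately show ?thesis by (simp add: cmod_def)
qed

text \<open>With \<open>\<kappa> = 2071/5000\<close> the claim follows, after squaring, from
\<open>2 * \<kappa> + \<kappa>\<^sup>2 \<le> 1\<close> and \<open>sqrt k \<le> k\<close>; the best
constant is \<open>\<kappa> = sqrt 2 - 1\<close>.\<close>

lemma sqrt_Suc_lower: "1 + 2071/5000 * sqrt (real k) \<le> sqrt (real k + 1)"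
proof (rule real_le_rsqrt)
  have "sqrt (real k) \<le> real k"
    by (cases k) (auto intro!: real_le_lsqrt simp: power2_eq_square)
  moreover have "(1 + 2071/5000 * sqrt (real k))\<^sup>2 = 1 + 2071/2500 * sqrt (real k) + (2071/5000)\<^sup>2 * real k"
    by (simp add: power2_eq_square algebra_simps)
  ultimately show "(1 + 2071/5000 * sqrt (real k))\<^sup>2 \<le> real k + 1"
    by (simp add: power2_eq_square)
qed

lemma sum_sqrt_bump_linear:
  fixes h :: "'a \<Rightarrow> nat"
  assumes "finite X"
  shows "real (card (X \<inter> D)) + 2071/5000 * (\<Sum>x\<in>X. sqrt (h x)) \<le> (\<Sum>x\<in>X. sqrt (real (h x) + indicator D x))"
proof -
  have "real (card (X \<inter> D)) + 2071/5000 * (\<Sum>x\<in>X. sqrt (h x))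
      = (\<Sum>x\<in>X. indicator D x + 2071/5000 * sqrt (h x))"
    using assms by (simp add: sum.distrib sum_distrib_left sum_indicator_card)
  also have "\<dots> \<le> (\<Sum>x\<in>X. sqrt (real (h x) + indicator D x))"
  proof (intro sum_mono)
    fix x
    have "2071/5000 * sqrt (h x) \<le> sqrt (h x)" by simp
    then show "indicator D x + 2071/5000 * sqrt (h x) \<le> sqrt (real (h x) + indicator D x)"
      using sqrt_Suc_lower[of "h x"] by (simp add: indicator_def)
  qed
  finally show ?thesis .
qed

definition boundary :: "nat \<Rightarrow> (nat \<Rightarrow> nat) set \<Rightarrow> real" where
  "boundary n A = (\<Sum>x\<in>cube n \<inter> A. sqrt (exits n A x))"

definition density :: "nat \<Rightarrow> (nat \<Rightarrow> nat) set \<Rightarrow> real" where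
  "density n A = card (cube n \<inter> A) / 2 ^ n"

lemma density_bounds: "0 \<le> density n A" "density n A \<le> 1"
proof -
  have "card (cube n \<inter> A) \<le> 2 ^ n"
    using card_mono[OF finite_cube, of "cube n \<inter> A" n] card_cube[of n] by simp
  then have "real (card (cube n \<inter> A)) \<le> 2 ^ n"
    using of_nat_mono by fastforce
  then show "density n A \<le> 1" by (simp add: density_def)
qed (simp add: density_def)

lemma density_Suc: "density (Suc n) A = (density n (slice n 0 A) + density n (slice n 1 A)) / 2"
proof -
  have *: "real (card (cube n \<inter> A)) = (\<Sum>x\<in>cube n. indicator A x)" for n A
    by (simp add: sum_indicator_card finite_cube)
  show ?thesis
    unfolding density_def * sum_cube_Suc
    by (simp add: slice_def indicator_def sum.distrib field_simps)
qed

lemma boundary_Suc: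
  fixes n A defines "S \<equiv> \<lambda>U V. \<Sum>x\<in>cube n \<inter> U. sqrt (real (exits n U x) + indicator (- V) x)"
  shows "boundary (Suc n) A = S (slice n 0 A) (slice n 1 A) + S (slice n 1 A) (slice n 0 A)"
proof -
  have *: "(\<Sum>x\<in>cube n \<inter> U. g x) = (\<Sum>x\<in>cube n. if x \<in> U then g x else 0)"
    for n U and g :: "(nat \<Rightarrow> nat) \<Rightarrow> real"
    by (simp add: sum.inter_restrict finite_cube)
  show ?thesis
    unfolding boundary_def S_def * sum_cube_Suc sum.distrib[symmetric]
    by (intro sum.cong) (auto simp: exits_Suc slice_def indicator_def)
qed

text \<open>The part of \<open>U\<close> outside \<open>V\<close> has density at least
\<open>d\<close>, and both bounds increase with this density and with the boundary of
\<open>U\<close>.\<close>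

lemma bumped_slice:
  assumes IH: "2 ^ n * profile (density n U) \<le> boundary n U"
    and le: "density n V \<le> density n U"
  defines "d \<equiv> density n U - density n V"
  shows "2 ^ n * max (sqrt (d\<^sup>2 + (profile (density n U))\<^sup>2)) (d + 2071/5000 * profile (density n U))
    \<le> (\<Sum>x\<in>cube n \<inter> U. sqrt (real (exits n U x) + indicator (- V) x))"
proof -
  let ?N = "2 ^ n :: real" and ?profile = "profile (density n U)"
  let ?c = "real (card (cube n \<inter> U \<inter> - V))"
  have N: "0 < ?N" by simp
  have B0: "0 \<le> ?profile" using density_bounds by (intro profile_nonneg)
  have "card (cube n \<inter> U) \<le> card (cube n \<inter> V \<union> cube n \<inter> U \<inter> - V)"
    by (intro card_mono) (auto simp: finite_cube)
  also have "\<dots> \<le> card (cube n \<inter> V) + card (cube n \<inter> U \<inter> - V)" by (rule card_Un_le)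
  finally have "real (card (cube n \<inter> U)) - real (card (cube n \<inter> V)) \<le> ?c" by linarith
  moreover have "?N * d = real (card (cube n \<inter> U)) - real (card (cube n \<inter> V))"
    by (simp add: d_def density_def right_diff_distrib)
  ultimately have c: "?N * d \<le> ?c" by simp
  have d0: "0 \<le> d" using le by (simp add: d_def)
  have "?N * sqrt (d\<^sup>2 + ?profile\<^sup>2) = sqrt ((?N * d)\<^sup>2 + (?N * ?profile)\<^sup>2)"
    using N by (simp add: power_mult_distrib distrib_left[symmetric] real_sqrt_mult)
  also have "\<dots> \<le> sqrt (?c\<^sup>2 + (boundary n U)\<^sup>2)"
    using c d0 B0 IH by (intro real_sqrt_le_mono add_mono power_mono) auto
  also have "\<dots> \<le> (\<Sum>x\<in>cube n \<inter> U. sqrt (real (exits n U x) + indicator (- V) x))"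
    unfolding boundary_def by (intro sum_sqrt_bump_minkowski) (auto simp: finite_cube)
  finally have 1: "?N * sqrt (d\<^sup>2 + ?profile\<^sup>2) \<le> (\<Sum>x\<in>cube n \<inter> U. sqrt (real (exits n U x) + indicator (- V) x))" .
  have "?N * (d + 2071/5000 * ?profile) \<le> ?c + 2071/5000 * boundary n U"
    using c IH by (simp add: algebra_simps)
  also have "\<dots> \<le> (\<Sum>x\<in>cube n \<inter> U. sqrt (real (exits n U x) + indicator (- V) x))"
    unfolding boundary_def by (intro sum_sqrt_bump_linear) (auto simp: finite_cube)
  finally show ?thesis using 1 by (simp add: max_def)
qed

lemma unbumped_slice:
  "boundary n U \<le> (\<Sum>x\<in>cube n \<inter> U. sqrt (real (exits n U x) + indicator V x))"
  unfolding boundary_def by (intro sum_mono) (auto simp: indicator_def)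

text \<open>Points of the denser slice outside the other slice gain an edge in the new direction;
the gain in the sparser slice is discarded.\<close>

theorem boundary_lower_bound: "2 ^ n * profile (density n A) \<le> boundary n A"
proof (induction n arbitrary: A)
  case 0
  have "card (cube 0 \<inter> A) \<le> 1" using card_mono[OF finite_cube, of "cube 0 \<inter> A" 0] card_cube[of 0] by simp
  then have "density 0 A = 0 \<or> density 0 A = 1" by (auto simp: density_def le_Suc_eq)
  then have "profile (density 0 A) = 0" by (auto simp: profile_def left_profile_def right_profile_def)
  then show ?case by (simp add: boundary_def sum_nonneg)
next
  case (Suc n)
  let ?S = "\<lambda>U V. \<Sum>x\<in>cube n \<inter> U. sqrt (real (exits n U x) + indicator (- V) x)"
  have step: "2 ^ Suc n * profile ((density n U + density n V) / 2) \<le> ?S U V + ?S V U"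
    if le: "density n V \<le> density n U" for U V
  proof -
    have "2 ^ Suc n * profile ((density n U + density n V) / 2) = 2 ^ n * (2 * profile ((density n U + density n V) / 2))"
      by simp
    also have "\<dots> \<le> 2 ^ n * (profile (density n V) + max (sqrt ((density n U - density n V)\<^sup>2 + (profile (density n U))\<^sup>2))
        ((density n U - density n V) + 2071/5000 * profile (density n U)))"
      using le density_bounds by (intro mult_left_mono two_point_inequality) auto
    also have "\<dots> \<le> ?S V U + ?S U V"
      unfolding distrib_left using bumped_slice[OF Suc.IH le] Suc.IH[of V] unbumped_slice[of n V "- U"]
      by (intro add_mono) auto
    finally show ?thesis by simp
  qed
  show ?case
    unfolding boundary_Suc density_Suc
    using step[of "slice n 1 A" "slice n 0 A"] step[of "slice n 0 A" "slice n 1 A"]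
    by (cases "density n (slice n 1 A) \<le> density n (slice n 0 A)") (simp_all add: add.commute)
qed

corollary two_sided_boundary:
  "2 ^ n * (4 * density n A * (1 - density n A)) \<le> boundary n A + boundary n (- A)"
proof -
  have "card (cube n \<inter> A) + card (cube n \<inter> - A) = card (cube n)"
    by (subst card_Un_disjoint[symmetric]) (auto simp: finite_cube intro!: arg_cong[where f = card])
  then have "real (card (cube n \<inter> A)) + real (card (cube n \<inter> - A)) = 2 ^ n"
    unfolding card_cube by (metis of_nat_add of_nat_numeral of_nat_power)
  then have "density n (- A) = 1 - density n A"
    by (simp add: density_def field_simps)
  then have "2 ^ n * (4 * density n A * (1 - density n A)) \<le> 2 ^ n * (profile (density n A) + profile (density n (- A)))"
    using two_sided_bound[OF density_bounds, of n A] by (intro mult_left_mono) auto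
  also have "\<dots> \<le> boundary n A + boundary n (- A)"
    unfolding distrib_left by (intro add_mono boundary_lower_bound)
  finally show ?thesis .
qed

section \<open>From edge boundaries to norms of the gradient\<close>

text \<open>The function \<open>p \<mapsto> u powr p\<close> is convex, and the right-hand side is
its chord over \<open>[1,2]\<close>. After division by \<open>u\<close> this is Bernoulli's
inequality \<open>u powr r \<le> 1 + r * (u - 1)\<close>, which follows from \<open>ln t \<le> t -
1\<close> at \<open>t = u / w\<close> and \<open>t = 1 / w\<close>, where \<open>w = 1 + r * (u -
1)\<close>.\<close>

lemma powr_le_chord:
  fixes u p :: real
  assumes "0 \<le> u" "1 \<le> p" "p \<le> 2"
  shows "u powr p \<le> (2 - p) * u + (p - 1) * u\<^sup>2"
proof (cases "u = 0")
  case False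
  then have u: "0 < u" using assms by simp
  define r where "r = p - 1"
  have r: "0 \<le> r" "r \<le> 1" using assms by (auto simp: r_def)
  define w where "w = 1 + r * (u - 1)"
  have w_eq: "w = (1 - r) + r * u" by (simp add: w_def algebra_simps)
  have w: "0 < w"
    unfolding w_eq using r u by (cases "r = 1") (auto intro: add_pos_nonneg)
  have "ln (u / w) \<le> u / w - 1" "ln (1 / w) \<le> 1 / w - 1"
    using u w by (auto intro!: ln_le_minus_one)
  then have "r * ln (u / w) + (1 - r) * ln (1 / w) \<le> r * (u / w - 1) + (1 - r) * (1 / w - 1)"
    using r by (intro add_mono mult_left_mono) auto
  also have "\<dots> = 0" using w by (simp add: w_eq field_simps)
  finally have "r * ln u \<le> ln w" using u w by (simp add: ln_div algebra_simps)
  then have "u powr r \<le> w" using u w by (simp add: powr_def ln_ge_iff[symmetric])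
  have "u powr p = u * u powr r" using u by (simp add: r_def powr_diff)
  also have "\<dots> \<le> u * w" using \<open>u powr r \<le> w\<close> u by (intro mult_left_mono) auto
  also have "\<dots> = (2 - p) * u + (p - 1) * u\<^sup>2" by (simp add: w_def r_def algebra_simps power2_eq_square)
  finally show ?thesis .
qed simp

lemma two_point_distribution_le:
  fixes a p :: real
  assumes "0 \<le> a" "a \<le> 1" "1 \<le> p" "p \<le> 2"
  shows "a * (1 - a) powr p + (1 - a) * a powr p \<le> (1/2) powr p * (4 * a * (1 - a))"
proof -
  have half: "b powr p \<le> (1/2) powr p * ((2 - p) * (2 * b) + (p - 1) * (2 * b)\<^sup>2)" if "0 \<le> b" for b
  proof -
    have "b powr p = (1/2) powr p * (2 * b) powr p" using that by (simp add: powr_mult[symmetric])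
    also have "\<dots> \<le> (1/2) powr p * ((2 - p) * (2 * b) + (p - 1) * (2 * b)\<^sup>2)"
      using that assms by (intro mult_left_mono powr_le_chord) auto
    finally show ?thesis .
  qed
  have "a * (1 - a) powr p + (1 - a) * a powr p
      \<le> a * ((1/2) powr p * ((2 - p) * (2 * (1 - a)) + (p - 1) * (2 * (1 - a))\<^sup>2))
        + (1 - a) * ((1/2) powr p * ((2 - p) * (2 * a) + (p - 1) * (2 * a)\<^sup>2))"
    using assms by (intro add_mono mult_left_mono half) auto
  also have "\<dots> = (1/2) powr p * (4 * a * (1 - a))"
    by (simp add: power2_eq_square algebra_simps)
  finally show ?thesis .
qed

lemma sum_split_indicator:
  "(\<Sum>x\<in>cube n. g x) = (\<Sum>x\<in>cube n \<inter> A. g x) + (\<Sum>x\<in>cube n \<inter> - A. g x)" for g :: "_ \<Rightarrow> real"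
  by (subst sum.union_disjoint[symmetric]) (auto simp: finite_cube intro!: sum.cong)

lemma card_compl_density: "real (card (cube n \<inter> A)) = 2 ^ n * density n A"
  "real (card (cube n \<inter> - A)) = 2 ^ n * (1 - density n A)"
proof -
  show 1: "real (card (cube n \<inter> A)) = 2 ^ n * density n A" by (simp add: density_def)
  have "(2::real) ^ n = (\<Sum>x\<in>cube n. 1)" by (simp add: card_cube)
  also have "\<dots> = real (card (cube n \<inter> A)) + real (card (cube n \<inter> - A))"
    by (subst sum_split_indicator[where A = A]) simp
  finally show "real (card (cube n \<inter> - A)) = 2 ^ n * (1 - density n A)" using 1 by (simp add: algebra_simps)
qed

lemma grad_eq_exits:
  assumes f: "f \<in> cube n \<rightarrow> {0, 1}" and A: "A = {x. f x = 1}" and x: "x \<in> cube n"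
  shows "grad n f x = sqrt (exits n (if x \<in> A then A else - A) x) / 2"
proof -
  have "(cmod ((f x - f (flip i x)) / 2))\<^sup>2 = (if flip i x \<notin> (if x \<in> A then A else - A) then 1/4 else 0)"
    if "i \<in> {1..n}" for i
  proof -
    have "f x \<in> {0, 1}" "f (flip i x) \<in> {0, 1}" using f x flip_in_cube[OF x that] by auto
    then show ?thesis by (auto simp: A power2_eq_square norm_divide)
  qed
  then have "(\<Sum>i\<in>{1..n}. (cmod ((f x - f (flip i x)) / 2))\<^sup>2)
      = (\<Sum>i\<in>{1..n}. if flip i x \<notin> (if x \<in> A then A else - A) then 1/4 else 0)"
    by (intro sum.cong) auto
  also have "\<dots> = real (exits n (if x \<in> A then A else - A) x) / 4"
    unfolding exits_def by (simp add: sum.inter_filter[symmetric])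
  finally show ?thesis unfolding grad_def by (simp only: real_sqrt_divide real_sqrt_four)
qed

lemma grad_powr_sum_ge:
  assumes f: "f \<in> cube n \<rightarrow> {0, 1}" and A: "A = {x. f x = 1}" and p: "1 \<le> p"
  shows "(1/2) powr p * (boundary n A + boundary n (- A)) \<le> (\<Sum>x\<in>cube n. norm (grad n f x) powr p)"
proof -
  have ge: "(1/2) powr p * sqrt (exits n U x) \<le> norm (grad n f x) powr p"
    if "x \<in> cube n" "U = (if x \<in> A then A else - A)" for x U
  proof -
    have "sqrt (exits n U x) \<le> sqrt (exits n U x) powr p"
    proof (cases "exits n U x = 0")
      case False
      then have "1 \<le> sqrt (exits n U x)" by simp
      then show ?thesis using powr_mono[OF p, of "sqrt (exits n U x)"] by simp
    qed simp
    then show ?thesis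
      unfolding grad_eq_exits[OF f A that(1)] that(2)[symmetric] by (simp add: powr_divide divide_right_mono)
  qed
  have "(1/2) powr p * (boundary n A + boundary n (- A))
      = (\<Sum>x\<in>cube n \<inter> A. (1/2) powr p * sqrt (exits n A x))
        + (\<Sum>x\<in>cube n \<inter> - A. (1/2) powr p * sqrt (exits n (- A) x))"
    unfolding boundary_def by (simp add: distrib_left sum_distrib_left)
  also have "\<dots> \<le> (\<Sum>x\<in>cube n \<inter> A. norm (grad n f x) powr p)
      + (\<Sum>x\<in>cube n \<inter> - A. norm (grad n f x) powr p)"
    by (intro add_mono sum_mono ge) auto
  also have "\<dots> = (\<Sum>x\<in>cube n. norm (grad n f x) powr p)"
    by (rule sum_split_indicator[symmetric])
  finally show ?thesis .
qed

lemma mean_eq_density: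
  fixes f :: "(nat \<Rightarrow> nat) \<Rightarrow> complex"
  assumes f: "f \<in> cube n \<rightarrow> {0, 1}" and A: "A = {x. f x = 1}"
  shows "mean n f = of_real (density n A)"
proof -
  have "(\<Sum>x\<in>cube n. f x) = (\<Sum>x\<in>cube n. of_real (indicator A x))"
    using f by (intro sum.cong) (auto simp: A indicator_def)
  also have "\<dots> = of_real (real (card (cube n \<inter> A)))"
    unfolding of_real_sum[symmetric] by (simp only: sum_indicator_card finite_cube)
  finally show ?thesis by (simp add: mean_def density_def)
qed

lemma deviation_powr_sum:
  fixes f :: "(nat \<Rightarrow> nat) \<Rightarrow> complex"
  assumes f: "f \<in> cube n \<rightarrow> {0, 1}" and A: "A = {x. f x = 1}"
  defines "a \<equiv> density n A"
  shows "(\<Sum>x\<in>cube n. norm (f x - mean n f) powr p) = 2 ^ n * (a * (1 - a) powr p + (1 - a) * a powr p)"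
proof -
  have a: "0 \<le> a" "a \<le> 1" unfolding a_def by (rule density_bounds)+
  have in_A: "norm (f x - mean n f) = 1 - a" if "x \<in> cube n \<inter> A" for x
  proof -
    have "f x - mean n f = of_real (1 - a)" using that by (simp add: mean_eq_density[OF f A] A a_def)
    then show ?thesis using a by (simp only: norm_of_real)
  qed
  have out_A: "norm (f x - mean n f) = a" if "x \<in> cube n \<inter> - A" for x
  proof -
    have "f x = 0" using that f A by auto
    then have "f x - mean n f = of_real (- a)" by (simp add: mean_eq_density[OF f A] a_def)
    then show ?thesis using a by (simp only: norm_of_real)
  qed
  have "(\<Sum>x\<in>cube n. norm (f x - mean n f) powr p)
      = (\<Sum>x\<in>cube n \<inter> A. (1 - a) powr p) + (\<Sum>x\<in>cube n \<inter> - A. a powr p)"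
    by (subst sum_split_indicator[where A = A]) (simp add: in_A out_A)
  then show ?thesis
    by (simp add: card_compl_density(1)[of n A] card_compl_density(2)[of n A] a_def algebra_simps)
qed

lemma lp_norm_mono:
  assumes "(\<Sum>x\<in>cube n. norm (f x) powr p) \<le> (\<Sum>x\<in>cube n. norm (g x) powr p)" "0 < p"
  shows "lp_norm n p f \<le> lp_norm n p g"
  unfolding lp_norm_def mean_def
  using assms by (intro powr_mono2 divide_right_mono) (auto intro!: divide_nonneg_nonneg sum_nonneg)

text \<open>With \<open>A = {x. f x = 1}\<close>, the left-hand side depends only on the density of
\<open>A\<close>, and the right-hand side is bounded below by the boundaries of \<open>A\<close> and
of its complement.\<close>

theorem poincare_boolean:
  fixes f :: "(nat \<Rightarrow> nat) \<Rightarrow> complex"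
  assumes f: "f \<in> cube n \<rightarrow> {0, 1}" and p: "1 \<le> p" "p \<le> 2"
  shows "lp_norm n p (\<lambda>x. f x - mean n f) \<le> lp_norm n p (grad n f)"
proof (rule lp_norm_mono)
  define A where "A = {x. f x = 1}"
  define a where "a = density n A"
  have "(\<Sum>x\<in>cube n. norm (f x - mean n f) powr p) = 2 ^ n * (a * (1 - a) powr p + (1 - a) * a powr p)"
    unfolding a_def by (rule deviation_powr_sum[OF f A_def])
  also have "\<dots> \<le> 2 ^ n * ((1/2) powr p * (4 * a * (1 - a)))"
    using p density_bounds unfolding a_def by (intro mult_left_mono two_point_distribution_le) auto
  also have "\<dots> = (1/2) powr p * (2 ^ n * (4 * a * (1 - a)))" by simp
  also have "\<dots> \<le> (1/2) powr p * (boundary n A + boundary n (- A))"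
    unfolding a_def by (intro mult_left_mono two_sided_boundary) simp
  also have "\<dots> \<le> (\<Sum>x\<in>cube n. norm (grad n f x) powr p)"
    by (rule grad_powr_sum_ge[OF f A_def p(1)])
  finally show "(\<Sum>x\<in>cube n. norm (f x - mean n f) powr p) \<le> (\<Sum>x\<in>cube n. norm (grad n f x) powr p)" .
qed (use p in simp)

lemma half_cube_equality:
  fixes f :: "(nat \<Rightarrow> nat) \<Rightarrow> complex"
  assumes A: "half_cube n A" and f: "f = indicator A"
  shows "lp_norm n p (grad n f) = lp_norm n p (\<lambda>x. f x - mean n f)"
proof -
  obtain i a where i: "i \<in> {1..n}" and a: "a \<in> {0, 1}" and A_eq: "A = {x \<in> cube n. x i = a}"
    using A unfolding half_cube_def by blast
  have flip_A: "flip j x \<in> A \<longleftrightarrow> (if j = i then x \<notin> A else x \<in> A)" if "x \<in> cube n" "j \<in> {1..n}" for x j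
  proof -
    have "x i \<in> {0, 1}" using that i by (auto simp: cube_def)
    then show ?thesis using that flip_in_cube[OF that] a by (auto simp: A_eq flip_def)
  qed
  have grad: "grad n f x = 1/2" if "x \<in> cube n" for x
  proof -
    have "(cmod ((f x - f (flip j x)) / 2))\<^sup>2 = (if j = i then 1/4 else 0)" if "j \<in> {1..n}" for j
      using flip_A[OF \<open>x \<in> cube n\<close> that] by (auto simp: f indicator_def power2_eq_square norm_divide)
    then have "(\<Sum>j\<in>{1..n}. (cmod ((f x - f (flip j x)) / 2))\<^sup>2) = (\<Sum>j\<in>{1..n}. if j = i then 1/4 else 0)"
      by (intro sum.cong) auto
    also have "\<dots> = 1/4" using i by simp
    finally show ?thesis unfolding grad_def by (simp only: real_sqrt_divide real_sqrt_four real_sqrt_one)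
  qed
  have flip_flip: "flip i (flip i x) = x" if "x \<in> cube n" for x
  proof -
    have "x i \<in> {0, 1}" using that i by (auto simp: cube_def)
    then show ?thesis by (auto simp: flip_def fun_eq_iff)
  qed
  have "(\<Sum>x\<in>cube n. f (flip i x)) = (\<Sum>x\<in>cube n. f x)"
    by (rule sum.reindex_bij_witness[where i = "flip i" and j = "flip i"])
      (use i flip_flip flip_in_cube in auto)
  then have "2 * (\<Sum>x\<in>cube n. f x) = (\<Sum>x\<in>cube n. f x + f (flip i x))" by (simp add: sum.distrib)
  also have "\<dots> = (\<Sum>x\<in>cube n. 1)"
    using flip_A i by (intro sum.cong) (auto simp: f indicator_def)
  also have "\<dots> = 2 ^ n" by (simp add: card_cube)
  finally have mean: "mean n f = 1/2" by (simp add: mean_def field_simps)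
  have dev: "norm (f x - mean n f) = 1/2" for x
    unfolding mean by (cases "x \<in> A") (auto simp: f norm_divide)
  have eq: "(\<Sum>x\<in>cube n. norm (grad n f x) powr p) = (\<Sum>x\<in>cube n. norm (f x - mean n f) powr p)"
    unfolding dev by (intro sum.cong) (simp_all add: grad)
  show ?thesis unfolding lp_norm_def mean_def[where 'a = real] eq by (rule refl)
qed

theorem theorem1p10:
  shows "(\<forall>(p::real) (n::nat) (f :: (nat \<Rightarrow> nat) \<Rightarrow> complex).
            2 * beta0 \<le> p \<and> p \<le> 2 \<and> 1 \<le> n \<and> f \<in> cube n \<rightarrow> {0, 1} \<longrightarrow>
            lp_norm n p (grad n f) \<ge> lp_norm n p (\<lambda>x. f x - mean n f))
       \<and> (\<forall>(p::real) (n::nat) (A :: (nat \<Rightarrow> nat) set) (f :: (nat \<Rightarrow> nat) \<Rightarrow> complex).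
            2 * beta0 \<le> p \<and> p \<le> 2 \<and> 1 \<le> n \<and> half_cube n A \<and> f = indicator A \<longrightarrow>
            lp_norm n p (grad n f) = lp_norm n p (\<lambda>x. f x - mean n f))
       \<and> (\<forall>(n::nat) (f :: (nat \<Rightarrow> nat) \<Rightarrow> complex).
            1 \<le> n \<and> f \<in> cube n \<rightarrow> {0, 1} \<longrightarrow>
            lp_norm n 1 (grad n f) \<ge> 0.997 * lp_norm n 1 (\<lambda>x. f x - mean n f))"
proof (intro conjI allI impI; elim conjE)
  fix p n and f :: "(nat \<Rightarrow> nat) \<Rightarrow> complex"
  assume "2 * beta0 \<le> p" "p \<le> 2" "f \<in> cube n \<rightarrow> {0, 1}"
  then show "lp_norm n p (\<lambda>x. f x - mean n f) \<le> lp_norm n p (grad n f)"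
    by (intro poincare_boolean) (auto simp: beta0_def)
next
  fix p n A and f :: "(nat \<Rightarrow> nat) \<Rightarrow> complex"
  assume "half_cube n A" "f = indicator A"
  then show "lp_norm n p (grad n f) = lp_norm n p (\<lambda>x. f x - mean n f)"
    by (rule half_cube_equality)
next
  fix n and f :: "(nat \<Rightarrow> nat) \<Rightarrow> complex"
  assume "f \<in> cube n \<rightarrow> {0, 1}"
  then have "lp_norm n 1 (\<lambda>x. f x - mean n f) \<le> lp_norm n 1 (grad n f)"
    by (intro poincare_boolean) auto
  moreover have "0.997 * lp_norm n 1 (\<lambda>x. f x - mean n f) \<le> 1 * lp_norm n 1 (\<lambda>x. f x - mean n f)"
    by (intro mult_right_mono) (auto simp: lp_norm_def)
  ultimately show "0.997 * lp_norm n 1 (\<lambda>x. f x - mean n f) \<le> lp_norm n 1 (grad n f)" by linarith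
qed

end
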